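(* Let $q$ be a prime power and $d$ a positive integer dividing $q-1$. Let $$\mathcal{E}=\{(2,1),(3,1),(3,2),(4,3),(5,2),(5,4),(7,2),(7,3),(7,6),(13,4)\}.$$ If $(q,d)\in\mathcal{E}$, then no orthomorphism in $\mathscr{D}_d(q)$ is orthogonal to a linear orthomorphism. If $(q,d)\notin\mathcal{E}$, and it is not the case that $d>50$ and ($q=2d+1\equiv3\pmod 4$ or $q=3d+1$), then there exists an orthomorphism $\theta\in\mathscr{D}_d(q)$ which is orthogonal to some linear orthomorphism over $\mathbb{F}_q$.
   Context: Let $\mathbb{F}_q$ be the finite field of order $q$. An orthomorphism is a permutation $\theta$ of $\mathbb{F}_q$ such that $x\mapsto\theta(x)-x$ is also a permutation. Two orthomorphisms $\theta,\theta'$ are orthogonal if $x\mapsto\theta(x)-\theta'(x)$ is a permutation. For $k\mid(q-1)$, fix a generator $g$ of $\mathbb{F}_q^*$ and let $C_{k,i}=\{g^j: j\equiv i\pmod k\}$, $0\le i<k$. A cyclotomic map of index $k$ with multipliers $[a_0,\dots,a_{k-1}]$ is $\theta(0)=0$, $\theta(x)=a_ix$ for $x\in C_{k,i}$. $\mathscr{C}_k(q)$ is the set of orthomorphisms that are cyclotomic maps of index $k$, and $\mathscr{D}_k(q)=\mathscr{C}_k(q)\setminus\bigcup_{\ell<k,\ \ell\mid(q-1)}\mathscr{C}_\ell(q)$. A linear orthomorphism is an element of $\mathscr{C}_1(q)$, i.e. a map $x\mapsto cx$ with $c\in\mathbb{F}_q\setminus\{0,1\}$. *)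

theory Defs
  imports "HOL-Number_Theory.Cong" "HOL-Library.Cardinality"
begin

text \<open>The field \<open>\<bbbF>\<^sub>q\<close> is a type of class \<open>{field, finite}\<close> with \<open>q = CARD('a)\<close>.\<close>

definition orthomorphism :: "('a::{field,finite} \<Rightarrow> 'a) \<Rightarrow> bool" where
  "orthomorphism \<theta> \<longleftrightarrow> bij \<theta> \<and> bij (\<lambda>x. \<theta> x - x)"

definition orthogonal_orth :: "('a::{field,finite} \<Rightarrow> 'a) \<Rightarrow> ('a \<Rightarrow> 'a) \<Rightarrow> bool" where
  "orthogonal_orth \<theta> \<theta>' \<longleftrightarrow>
     orthomorphism \<theta> \<and> orthomorphism \<theta>' \<and> bij (\<lambda>x. \<theta> x - \<theta>' x)"

definition mult_generator :: "'a::{field,finite} \<Rightarrow> bool" where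
  "mult_generator g \<longleftrightarrow> range (\<lambda>j::nat. g ^ j) = UNIV - {0}"

text \<open>Natural exponents suffice: \<open>g\<close> has finite order, and only indices \<open>k\<close> dividing
  that order \<open>q - 1\<close> are used, so integer exponents would give the same sets.\<close>

definition cyclotomic_class :: "'a::{field,finite} \<Rightarrow> nat \<Rightarrow> nat \<Rightarrow> 'a set" where
  "cyclotomic_class g k i = {g ^ j | j. [j = i] (mod k)}"

text \<open>Only the multipliers \<open>a i\<close> with \<open>i < k\<close> are relevant.\<close>

definition cyclotomic_map ::
    "'a::{field,finite} \<Rightarrow> nat \<Rightarrow> (nat \<Rightarrow> 'a) \<Rightarrow> ('a \<Rightarrow> 'a) \<Rightarrow> bool" where
  "cyclotomic_map g k a \<theta> \<longleftrightarrow>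
     \<theta> 0 = 0 \<and> (\<forall>i<k. \<forall>x\<in>cyclotomic_class g k i. \<theta> x = a i * x)"

definition cyclotomic_orths :: "'a::{field,finite} \<Rightarrow> nat \<Rightarrow> ('a \<Rightarrow> 'a) set" where
  "cyclotomic_orths g k = {\<theta>. orthomorphism \<theta> \<and> (\<exists>a. cyclotomic_map g k a \<theta>)}"

definition proper_cyclotomic_orths :: "'a::{field,finite} \<Rightarrow> nat \<Rightarrow> ('a \<Rightarrow> 'a) set" where
  "proper_cyclotomic_orths g k =
     cyclotomic_orths g k - (\<Union>l\<in>{l. l < k \<and> l dvd CARD('a) - 1}. cyclotomic_orths g l)"

definition linear_orths :: "'a::{field,finite} \<Rightarrow> ('a \<Rightarrow> 'a) set" where
  "linear_orths g = cyclotomic_orths g 1"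

definition exceptional_pairs :: "(nat \<times> nat) set" where
  "exceptional_pairs =
     {(2,1), (3,1), (3,2), (4,3), (5,2), (5,4), (7,2), (7,3), (7,6), (13,4)}"

end

theory Submission
  imports Defs "HOL-Number_Theory.Residues" "HOL-Algebra.Sylow"
begin

text \<open>
  Put \<open>n = (q - 1) / d\<close>. A map \<open>\<theta>\<close> with \<open>\<theta> 0 = 0\<close> is cyclotomic of index \<open>d\<close> iff it commutes with
  multiplication by all \<open>n\<close>-th roots of unity, and of least index \<open>d\<close> iff it commutes with no
  other nonzero multiplication.

  If \<open>H\<close> is a multiplicative subgroup of order at least 4, then \<open>a\<close>, \<open>u\<close>, \<open>c\<close> can be solved from
  \<open>u \<in> a H\<close>, \<open>u - 1 \<in> (a - 1) H\<close>, \<open>u - c \<in> (a - c) H\<close>, so replacing \<open>a x\<close> by \<open>u x\<close> on \<open>H\<close> keeps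
  \<open>\<theta>\<close>, \<open>\<theta> - x\<close> and \<open>\<theta> - c x\<close> bijective. For \<open>n \<ge> 4\<close> this is the wanted map. For \<open>n \<le> 3\<close> the same
  change is made around the centres \<open>\<sigma> s\<close>, where \<open>\<sigma>\<close> runs through the \<open>n\<close>-th roots of unity: the
  translates \<open>\<sigma> s + H\<close> are disjoint for a suitable \<open>s\<close>, because \<open>H - H\<close> has at most
  \<open>1 + |H|\<^sup>2 / 2\<close> elements. The fields without a fitting \<open>H\<close> are handled by the additive maps
  \<open>a x + b x\<^sup>3\<close>, \<open>a x + b x\<^sup>4\<close> and \<open>x \<mapsto> a x + b [x \<notin> V]\<close> in characteristics 3 and 2, and by explicit
  maps in eight cases over prime fields. Nonexistence is a backtracking search.
\<close>

subsection \<open>Cyclotomic maps and commuting multiplications\<close>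

lemma finite_field_power_card_minus_1:
  fixes x :: "'a::{field,finite}"
  assumes "x \<noteq> 0"
  shows "x ^ (CARD('a) - 1) = 1"
proof -
  let ?U = "UNIV - {0} :: 'a set"
  have img: "(\<lambda>y. x * y) ` ?U = ?U"
  proof
    show "?U \<subseteq> (\<lambda>y. x * y) ` ?U"
    proof
      fix y :: 'a assume "y \<in> ?U"
      then have "y = x * (y / x)" "y / x \<in> ?U" using assms by auto
      then show "y \<in> (\<lambda>y. x * y) ` ?U" by blast
    qed
  qed (use assms in auto)
  have "inj_on (\<lambda>y. x * y) ?U" using assms by (auto simp: inj_on_def)
  then have "prod id ?U = prod (id \<circ> (\<lambda>y. x * y)) ?U"
    using prod.reindex[of "\<lambda>y. x * y" ?U id] img by simp
  also have "\<dots> = x ^ card ?U * prod id ?U" by (simp add: prod.distrib)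
  finally show ?thesis by (simp add: card_Diff_singleton)
qed

lemma mult_generator_nonzero:
  fixes g :: "'a::{field,finite}"
  assumes "mult_generator g"
  shows "g \<noteq> 0"
proof -
  have "g ^ 1 \<in> range (\<lambda>j::nat. g ^ j)" by blast
  then show ?thesis using assms by (auto simp: mult_generator_def)
qed

lemma mult_generator_cases:
  fixes g :: "'a::{field,finite}"
  assumes "mult_generator g" "x \<noteq> 0"
  obtains j where "x = g ^ j"
  using assms by (auto simp: mult_generator_def)

lemma card_field_gt_1: "CARD('a::{field,finite}) > 1"
proof -
  have "card {0, 1 :: 'a} \<le> CARD('a)" by (rule card_mono) auto
  then show ?thesis by simp
qed

lemma mult_generator_power_mod:
  fixes g :: "'a::{field,finite}"
  assumes "mult_generator g"
  shows "g ^ (m mod (CARD('a) - 1)) = g ^ m"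
proof -
  let ?N = "CARD('a) - 1"
  have "g ^ m = g ^ (?N * (m div ?N) + m mod ?N)" by simp
  also have "\<dots> = (g ^ ?N) ^ (m div ?N) * g ^ (m mod ?N)"
    unfolding power_add power_mult ..
  also have "g ^ ?N = 1"
    using assms by (intro finite_field_power_card_minus_1 mult_generator_nonzero)
  finally show ?thesis by simp
qed

text \<open>The exponents below q - 1 already reach all q - 1 nonzero elements, so these powers are
  distinct and among them only the exponent 0 gives 1.\<close>

lemma mult_generator_power_eq_1_iff:
  fixes g :: "'a::{field,finite}"
  assumes "mult_generator g"
  shows "g ^ m = 1 \<longleftrightarrow> CARD('a) - 1 dvd m"
proof
  let ?N = "CARD('a) - 1"
  have N: "?N > 0" using card_field_gt_1[where 'a='a] by simp
  have "(\<lambda>j. g ^ j) ` {..<?N} = UNIV - {0}"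
  proof
    show "UNIV - {0} \<subseteq> (\<lambda>j. g ^ j) ` {..<?N}"
    proof
      fix x :: 'a assume "x \<in> UNIV - {0}"
      then obtain j where "x = g ^ j" using mult_generator_cases[OF assms] by auto
      then have "x = g ^ (j mod ?N)" by (metis mult_generator_power_mod[OF assms])
      then show "x \<in> (\<lambda>j. g ^ j) ` {..<?N}" using N by auto
    qed
  qed (use mult_generator_nonzero[OF assms] in auto)
  then have inj: "inj_on (\<lambda>j. g ^ j) {..<?N}"
    by (intro eq_card_imp_inj_on) (auto simp: card_Diff_singleton)
  assume "g ^ m = 1"
  then have "g ^ (m mod ?N) = g ^ 0" unfolding mult_generator_power_mod[OF assms] by simp
  then have "m mod ?N = 0" using N by (intro inj_onD[OF inj]) auto
  then show "?N dvd m" by auto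
next
  assume "CARD('a) - 1 dvd m"
  then show "g ^ m = 1"
    by (metis mult_generator_power_mod[OF assms] dvd_imp_mod_0 power_0)
qed

text \<open>A power \<open>g ^ m\<close> is an \<open>e\<close>-th root of unity iff (q - 1) / e
  divides \<open>m\<close>, which leaves exactly \<open>e\<close> exponents below q - 1.\<close>

lemma card_roots_of_unity:
  fixes g :: "'a::{field,finite}"
  assumes g: "mult_generator g" and e: "e dvd CARD('a) - 1"
  shows "{h :: 'a. h ^ e = 1} = (\<lambda>j. (g ^ ((CARD('a) - 1) div e)) ^ j) ` {..<e}"
    and "card {h :: 'a. h ^ e = 1} = e"
proof -
  let ?N = "CARD('a) - 1"
  define f where "f = ?N div e"
  have N: "?N > 0" using card_field_gt_1[where 'a='a] by simp
  have Nf: "?N = f * e" using e by (simp add: f_def)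
  then have e0: "e > 0" and f0: "f > 0" using N by (auto intro: gr0I)
  show eq: "{h :: 'a. h ^ e = 1} = (\<lambda>j. (g ^ (?N div e)) ^ j) ` {..<e}"
  proof (intro equalityI subsetI)
    fix h :: 'a assume h: "h \<in> {h. h ^ e = 1}"
    then have "h \<noteq> 0" using e0 by (auto simp: zero_power)
    then obtain m where m: "h = g ^ m" using mult_generator_cases[OF g] by auto
    have "g ^ (m * e) = 1" using h m by (simp add: power_mult)
    then have "f * e dvd m * e" using mult_generator_power_eq_1_iff[OF g] Nf by metis
    then obtain t where t: "m = f * t" using e0 by auto
    have "m mod ?N = f * (t mod e)" unfolding t Nf by simp
    then have "h = (g ^ f) ^ (t mod e)"
      by (metis m mult_generator_power_mod[OF g] power_mult)
    then show "h \<in> (\<lambda>j. (g ^ (?N div e)) ^ j) ` {..<e}" using e0 by (auto simp: f_def)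
  next
    fix h assume "h \<in> (\<lambda>j. (g ^ (?N div e)) ^ j) ` {..<e}"
    then obtain j where "h = g ^ (f * j)" by (auto simp: f_def power_mult)
    then have "h ^ e = g ^ (?N * j)" by (simp only: Nf mult_ac power_mult[symmetric])
    then show "h \<in> {h. h ^ e = 1}" by (simp add: mult_generator_power_eq_1_iff[OF g])
  qed
  have "inj_on (\<lambda>j. (g ^ f) ^ j) {..<e}"
  proof (rule linorder_inj_onI)
    fix x y assume "x < y" and xy: "x \<in> {..<e}" "y \<in> {..<e}"
    show "(g ^ f) ^ x \<noteq> (g ^ f) ^ y"
    proof
      assume "(g ^ f) ^ x = (g ^ f) ^ y"
      also have "\<dots> = (g ^ f) ^ x * (g ^ f) ^ (y - x)"
        using \<open>x < y\<close> by (simp flip: power_add)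
      finally have "g ^ (f * (y - x)) = 1"
        using mult_generator_nonzero[OF g] by (simp add: power_mult)
      then have "f * e dvd f * (y - x)" using mult_generator_power_eq_1_iff[OF g] Nf by metis
      then have "e dvd y - x" using f0 by simp
      then show False using \<open>x < y\<close> xy by (auto dest!: dvd_imp_le)
    qed
  qed auto
  then show "card {h :: 'a. h ^ e = 1} = e" by (simp add: eq f_def card_image)
qed

text \<open>With n = (q - 1) / k, the n-th roots of unity are the powers \<open>g ^ m\<close> with
  \<open>k dvd m\<close>, and the class of index \<open>i\<close> is their coset through
  \<open>g ^ i\<close>. One multiplier per coset amounts to commuting with these roots.\<close>

lemma cyclotomic_orths_iff:
  fixes g :: "'a::{field,finite}"
  assumes g: "mult_generator g" and k: "k > 0" "k dvd CARD('a) - 1"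
  shows "\<theta> \<in> cyclotomic_orths g k \<longleftrightarrow> orthomorphism \<theta> \<and> \<theta> 0 = 0 \<and>
    (\<forall>h x. h ^ ((CARD('a) - 1) div k) = 1 \<longrightarrow> \<theta> (h * x) = h * \<theta> x)"
proof (intro iffI conjI allI impI)
  let ?N = "CARD('a) - 1"
  define n where "n = ?N div k"
  have Nn: "?N = n * k" using k by (simp add: n_def)
  have n0: "n > 0" using Nn card_field_gt_1[where 'a='a] by (auto intro: gr0I)
  {
    assume "\<theta> \<in> cyclotomic_orths g k"
    then obtain a where o: "orthomorphism \<theta>" and a: "cyclotomic_map g k a \<theta>"
      by (auto simp: cyclotomic_orths_def)
    show "orthomorphism \<theta>" "\<theta> 0 = 0" using o a by (auto simp: cyclotomic_map_def)
    have val: "\<theta> (g ^ j) = a (j mod k) * g ^ j" for j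
    proof -
      have "g ^ j \<in> cyclotomic_class g k (j mod k)"
        by (auto simp: cyclotomic_class_def cong_def)
      then show ?thesis using a k by (simp add: cyclotomic_map_def)
    qed
    fix h x :: 'a
    assume "h ^ (?N div k) = 1"
    then have hn: "h ^ n = 1" by (simp add: n_def)
    then have "h \<noteq> 0" using n0 by (auto simp: zero_power)
    then obtain m where m: "h = g ^ m" using mult_generator_cases[OF g] by auto
    have "g ^ (m * n) = 1" using hn m by (simp add: power_mult)
    then have "n * k dvd m * n" using mult_generator_power_eq_1_iff[OF g] Nn by metis
    then have km: "k dvd m" using n0 by (simp add: mult.commute)
    show "\<theta> (h * x) = h * \<theta> x"
    proof (cases "x = 0")
      case True
      then show ?thesis by (simp add: \<open>\<theta> 0 = 0\<close>)
    next
      case False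
      then obtain j where j: "x = g ^ j" using mult_generator_cases[OF g] by auto
      have "(m + j) mod k = j mod k" using km by (auto simp: dvd_def)
      then show ?thesis using val[of "m + j"] val[of j] by (simp add: m j power_add mult_ac)
    qed
  }
  assume R: "orthomorphism \<theta> \<and> \<theta> 0 = 0 \<and> (\<forall>h x. h ^ (?N div k) = 1 \<longrightarrow> \<theta> (h * x) = h * \<theta> x)"
  \<comment> \<open>The multiplier of a class is read off at its representative
    \<open>g ^ i\<close>.\<close>
  have "cyclotomic_map g k (\<lambda>i. \<theta> (g ^ i) / g ^ i) \<theta>"
    unfolding cyclotomic_map_def
  proof (intro conjI allI impI ballI)
    fix i x assume i: "i < k" and "x \<in> cyclotomic_class g k i"
    then obtain j where x: "x = g ^ j" and j: "j mod k = i"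
      by (auto simp: cyclotomic_class_def cong_def)
    define h where "h = g ^ (k * (j div k))"
    have "g ^ j = g ^ (k * (j div k) + j mod k)" by simp
    then have xh: "x = h * g ^ i" unfolding power_add j by (simp add: x h_def)
    have "h ^ n = g ^ (?N * (j div k))" by (simp only: h_def Nn mult_ac power_mult[symmetric])
    then have "h ^ n = 1" by (simp add: mult_generator_power_eq_1_iff[OF g])
    then have "\<theta> x = h * \<theta> (g ^ i)" using R xh by (auto simp: n_def)
    then show "\<theta> x = \<theta> (g ^ i) / g ^ i * x"
      using mult_generator_nonzero[OF g] by (simp add: xh)
  qed (use R in simp)
  then show "\<theta> \<in> cyclotomic_orths g k" using R by (auto simp: cyclotomic_orths_def)
qed

lemma linear_orths_iff:
  fixes g :: "'a::{field,finite}"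
  assumes g: "mult_generator g"
  shows "\<phi> \<in> linear_orths g \<longleftrightarrow> (\<exists>c. c \<noteq> 0 \<and> c \<noteq> 1 \<and> \<phi> = (\<lambda>x. c * x))"
proof
  assume "\<phi> \<in> linear_orths g"
  then have o: "orthomorphism \<phi>" and "\<phi> 0 = 0"
    and com: "\<And>h x. h ^ (CARD('a) - 1) = 1 \<Longrightarrow> \<phi> (h * x) = h * \<phi> x"
    using cyclotomic_orths_iff[OF g, of 1 \<phi>] by (auto simp: linear_orths_def)
  have lin: "\<phi> x = \<phi> 1 * x" for x
    using com[of x 1] finite_field_power_card_minus_1[of x] \<open>\<phi> 0 = 0\<close>
    by (cases "x = 0") (auto simp: mult.commute)
  have "inj \<phi>" "inj (\<lambda>x. \<phi> x - x)" using o by (auto simp: orthomorphism_def bij_def)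
  then have "\<phi> 1 \<noteq> \<phi> 0" "\<phi> 1 - 1 \<noteq> \<phi> 0 - 0"
    by (metis injD zero_neq_one)+
  then show "\<exists>c. c \<noteq> 0 \<and> c \<noteq> 1 \<and> \<phi> = (\<lambda>x. c * x)"
    using \<open>\<phi> 0 = 0\<close> by (intro exI[of _ "\<phi> 1"] conjI ext lin) auto
next
  assume "\<exists>c. c \<noteq> 0 \<and> c \<noteq> 1 \<and> \<phi> = (\<lambda>x. c * x)"
  then obtain c where c: "c \<noteq> 0" "c \<noteq> 1" and \<phi>: "\<phi> = (\<lambda>x. c * x)" by blast
  have "inj \<phi>" using c by (auto simp: \<phi> inj_def)
  moreover have "inj (\<lambda>x. \<phi> x - x)"
  proof (rule injI)
    fix x y assume "\<phi> x - x = \<phi> y - y"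
    then have "(c - 1) * (x - y) = 0" by (simp add: \<phi> algebra_simps)
    then show "x = y" using c by simp
  qed
  ultimately have "orthomorphism \<phi>"
    using finite_UNIV_inj_surj[OF finite, of \<phi>] finite_UNIV_inj_surj[OF finite, of "\<lambda>x. \<phi> x - x"]
    by (auto simp: orthomorphism_def bij_def)
  then show "\<phi> \<in> linear_orths g"
    using cyclotomic_orths_iff[OF g, of 1 \<phi>] by (auto simp: linear_orths_def \<phi> mult_ac)
qed

definition has_orthogonal_linear :: "'a::{field,finite} \<Rightarrow> nat \<Rightarrow> bool" where
  "has_orthogonal_linear g d \<longleftrightarrow>
     (\<exists>\<theta>\<in>proper_cyclotomic_orths g d. \<exists>\<phi>\<in>linear_orths g. orthogonal_orth \<theta> \<phi>)"

text \<open>The values 0, 1, \<open>c\<close> of \<open>t\<close> stand for the three permutations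
  demanded, and injectivity suffices by finiteness. The last hypothesis gives minimality: if
  \<open>\<theta>\<close> had an index \<open>l < d\<close>, it would commute with
  \<open>g ^ l\<close>, so that q - 1 = n d would divide l n.\<close>

lemma has_orthogonal_linearI:
  fixes g :: "'a::{field,finite}" and \<theta> :: "'a \<Rightarrow> 'a"
  assumes g: "mult_generator g" and d: "d > 0" and n: "CARD('a) - 1 = n * d"
    and c: "c \<noteq> 0" "c \<noteq> 1" and z: "\<theta> 0 = 0"
    and inj: "\<And>t. t \<in> {0, 1, c} \<Longrightarrow> inj (\<lambda>x. \<theta> x - t * x)"
    and com: "\<And>h x. h ^ n = 1 \<Longrightarrow> \<theta> (h * x) = h * \<theta> x"
    and only: "\<And>\<zeta>. \<zeta> \<noteq> 0 \<Longrightarrow> (\<And>x. \<theta> (\<zeta> * x) = \<zeta> * \<theta> x) \<Longrightarrow> \<zeta> ^ n = 1"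
  shows "has_orthogonal_linear g d"
  unfolding has_orthogonal_linear_def
proof (intro bexI)
  let ?N = "CARD('a) - 1"
  have N0: "?N > 0" using card_field_gt_1[where 'a='a] by simp
  have bij: "bij (\<lambda>x. \<theta> x - t * x)" if "t \<in> {0, 1, c}" for t
    using finite_UNIV_inj_surj[OF finite, of "\<lambda>x. \<theta> x - t * x"] inj[OF that]
    by (simp add: bij_def)
  have o: "orthomorphism \<theta>" using bij[of 0] bij[of 1] by (simp add: orthomorphism_def)
  have in_d: "\<theta> \<in> cyclotomic_orths g d"
    using cyclotomic_orths_iff[OF g d, of \<theta>] d n o z com by auto
  moreover have "\<theta> \<notin> cyclotomic_orths g l" if l: "l < d" "l dvd ?N" for l
  proof
    assume "\<theta> \<in> cyclotomic_orths g l"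
    moreover have l0: "l > 0" using l N0 by (auto intro: gr0I)
    ultimately have "\<theta> (g ^ l * x) = g ^ l * \<theta> x" for x
    proof -
      have "(g ^ l) ^ (?N div l) = 1"
        using l by (simp add: mult_generator_power_eq_1_iff[OF g] flip: power_mult)
      then show ?thesis
        using \<open>\<theta> \<in> cyclotomic_orths g l\<close> cyclotomic_orths_iff[OF g l0 l(2)] by blast
    qed
    then have "(g ^ l) ^ n = 1" using mult_generator_nonzero[OF g] by (intro only) auto
    then have "?N dvd l * n" by (simp add: mult_generator_power_eq_1_iff[OF g] flip: power_mult)
    moreover have "n > 0" using n N0 by (auto intro: gr0I)
    ultimately show False using l l0 n by (auto dest!: dvd_imp_le)
  qed
  ultimately show "\<theta> \<in> proper_cyclotomic_orths g d"
    by (auto simp: proper_cyclotomic_orths_def)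
  show \<phi>: "(\<lambda>x. c * x) \<in> linear_orths g" using linear_orths_iff[OF g] c by blast
  then show "orthogonal_orth \<theta> (\<lambda>x. c * x)"
    using o bij[of c] by (simp add: orthogonal_orth_def linear_orths_def cyclotomic_orths_def)
qed

subsection \<open>Linear maps changed on translates of a subgroup\<close>

text \<open>\<open>\<delta> x\<close> is the displacement of \<open>x\<close> from the centre of its
  translate of the group \<open>H\<close> of \<open>e\<close>-th roots of unity, and 0 off the
  translates. The hypothesis on shifts says that scaling a displacement by an element of
  \<open>H\<close> stays in the same translate. Three elements of \<open>H\<close> other than 1 are
  used, one for each \<open>t\<close> in 0, 1, \<open>c\<close>; hence
  \<open>e \<ge> 4\<close>.\<close>

lemma has_orthogonal_linear_patch:
  fixes g :: "'a::{field,finite}" and \<delta> :: "'a \<Rightarrow> 'a"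
  assumes g: "mult_generator g" and d: "d > 0" and n: "CARD('a) - 1 = n * d"
    and e: "e \<ge> 4" "e dvd CARD('a) - 1"
    and z: "\<delta> 0 = 0"
    and shift: "\<And>\<eta> x. \<eta> ^ e = 1 \<Longrightarrow> \<delta> (x + (\<eta> - 1) * \<delta> x) = \<eta> * \<delta> x"
    and com: "\<And>h x. h ^ n = 1 \<Longrightarrow> \<delta> (h * x) = h * \<delta> x"
    and only: "\<And>\<zeta>. \<zeta> \<noteq> 0 \<Longrightarrow> (\<And>x. \<delta> (\<zeta> * x) = \<zeta> * \<delta> x) \<Longrightarrow> \<zeta> ^ n = 1"
  shows "has_orthogonal_linear g d"
proof -
  define H where "H = {h :: 'a. h ^ e = 1}"
  have cH: "card H = e" unfolding H_def by (rule card_roots_of_unity[OF g e(2)])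
  have ex: "\<exists>h\<in>H. h \<notin> set xs" if "length xs < 4" for xs
  proof (rule ccontr)
    assume "\<not> ?thesis"
    then have "H \<subseteq> set xs" by blast
    then have "card H \<le> length xs" by (meson List.finite_set card_length card_mono le_trans)
    then show False using that cH e by simp
  qed
  obtain \<eta>1 where h1: "\<eta>1 \<in> H" "\<eta>1 \<noteq> 1" using ex[of "[1]"] by auto
  obtain \<eta>2 where h2: "\<eta>2 \<in> H" "\<eta>2 \<noteq> 1" "\<eta>2 \<noteq> \<eta>1" using ex[of "[1, \<eta>1]"] by auto
  obtain \<eta>3 where h3: "\<eta>3 \<in> H" "\<eta>3 \<noteq> 1" "\<eta>3 \<noteq> \<eta>1" "\<eta>3 \<noteq> \<eta>2"
    using ex[of "[1, \<eta>1, \<eta>2]"] by auto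
  \<comment> \<open>These solve the linear equations
    \<open>a * \<eta>1 - 1 = (a - 1) * \<eta>2\<close> and
    \<open>a * \<eta>1 - c = (a - c) * \<eta>3\<close>. Distinctness of 1 and the three roots keeps
    0, 1, \<open>a\<close>, \<open>c\<close> distinct.\<close>
  define a where "a = (1 - \<eta>2) / (\<eta>1 - \<eta>2)"
  define u where "u = a * \<eta>1"
  define c where "c = a * (\<eta>1 - \<eta>3) / (1 - \<eta>3)"
  have nz: "\<eta>1 - \<eta>2 \<noteq> 0" "1 - \<eta>3 \<noteq> 0" "1 - \<eta>2 \<noteq> 0" "\<eta>1 - 1 \<noteq> 0" "\<eta>1 - \<eta>3 \<noteq> 0"
    "\<eta>2 - \<eta>3 \<noteq> 0"
    using h1 h2 h3 by auto
  have e1: "a * (\<eta>1 - \<eta>2) = 1 - \<eta>2" using nz by (simp add: a_def)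
  have e2: "c * (1 - \<eta>3) = a * (\<eta>1 - \<eta>3)" using nz by (simp add: c_def)
  have a0: "a \<noteq> 0" using nz by (simp add: a_def)
  have a1: "a \<noteq> 1" using e1 nz by auto
  have c0: "c \<noteq> 0" using nz a0 by (simp add: c_def)
  have u1: "u - 1 = (a - 1) * \<eta>2" using e1 by (simp add: u_def algebra_simps)
  have uc: "u - c = (a - c) * \<eta>3" using e2 by (simp add: u_def algebra_simps)
  have c1: "c \<noteq> 1"
  proof
    assume "c = 1"
    then have "(a - 1) * \<eta>2 = (a - 1) * \<eta>3" using u1 uc by simp
    then show False using a1 nz by auto
  qed
  have ac: "a \<noteq> c"
  proof
    assume "a = c"
    then have "a * (\<eta>1 - 1) = 0" using e2 by (simp add: algebra_simps)
    then show False using nz a0 by auto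
  qed
  have ua: "u - a \<noteq> 0" using a0 h1 by (simp add: u_def)
  define \<theta> where "\<theta> = (\<lambda>x. a * x + (u - a) * \<delta> x)"
  show ?thesis
  proof (rule has_orthogonal_linearI[where \<theta> = \<theta> and c = c, OF g d n c0 c1])
    show "\<theta> 0 = 0" by (simp add: \<theta>_def z)
  next
    fix t assume t: "t \<in> {0, 1, c}"
    have "\<exists>\<eta>\<in>H. u - t = (a - t) * \<eta>"
      using t h1(1) h2(1) h3(1) u1 uc by (auto simp: u_def)
    then obtain \<eta> where \<eta>: "\<eta> \<in> H" "u - t = (a - t) * \<eta>" by blast
    have at: "a - t \<noteq> 0" using t a0 a1 ac by auto
    have "\<eta> \<noteq> 0" using \<eta>(1) e by (auto simp: H_def zero_power)
    \<comment> \<open>Up to the factor \<open>a - t\<close>, the map multiplies displacements by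
      \<open>\<eta>\<close>. Applying \<open>\<delta>\<close> to an image therefore recovers
      \<open>\<delta> x\<close>, and then \<open>x\<close>.\<close>
    have rw: "\<theta> x - t * x = (a - t) * (x + (\<eta> - 1) * \<delta> x)" for x
    proof -
      have "u - a = (a - t) * (\<eta> - 1)" using \<eta>(2) by (simp add: algebra_simps)
      then have "(u - a) * \<delta> x = (a - t) * (\<eta> - 1) * \<delta> x" by simp
      then show ?thesis by (simp add: \<theta>_def algebra_simps)
    qed
    show "inj (\<lambda>x. \<theta> x - t * x)"
    proof (rule injI)
      fix x y assume "\<theta> x - t * x = \<theta> y - t * y"
      then have eq: "x + (\<eta> - 1) * \<delta> x = y + (\<eta> - 1) * \<delta> y" using at by (simp add: rw)
      then have "\<eta> * \<delta> x = \<eta> * \<delta> y"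
        using shift[of \<eta> x, symmetric] shift[of \<eta> y] \<eta>(1) by (simp add: H_def)
      then show "x = y" using eq \<open>\<eta> \<noteq> 0\<close> by simp
    qed
  next
    fix h x :: 'a assume "h ^ n = 1"
    then show "\<theta> (h * x) = h * \<theta> x" by (simp add: \<theta>_def com algebra_simps)
  next
    fix \<zeta> assume "\<zeta> \<noteq> 0" and com: "\<And>x. \<theta> (\<zeta> * x) = \<zeta> * \<theta> x"
    have *: "(u - a) * \<delta> (\<zeta> * x) = (u - a) * (\<zeta> * \<delta> x)" for x
      using com[of x] unfolding \<theta>_def by (simp add: algebra_simps)
    have "\<delta> (\<zeta> * x) = \<zeta> * \<delta> x" for x using *[of x] ua by simp
    then show "\<zeta> ^ n = 1" using only \<open>\<zeta> \<noteq> 0\<close> by blast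
  qed
qed

text \<open>Here \<open>H\<close> consists of the \<open>n\<close>-th roots of unity themselves and
  the only centre is 0. A commuting \<open>\<zeta>\<close> lies in \<open>H\<close> because
  \<open>\<delta> \<zeta> = \<zeta> * \<delta> 1\<close> is nonzero.\<close>

lemma has_orthogonal_linear_large_subgroup:
  fixes g :: "'a::{field,finite}"
  assumes g: "mult_generator g" and d: "d > 0" and n: "CARD('a) - 1 = n * d" "n \<ge> 4"
  shows "has_orthogonal_linear g d"
proof (rule has_orthogonal_linear_patch[OF g d n(1) n(2),
      where \<delta> = "\<lambda>x. if x ^ n = 1 then x else 0"])
  let ?\<delta> = "\<lambda>x::'a. if x ^ n = 1 then x else 0"
  show "n dvd CARD('a) - 1" using n(1) by simp
  show "?\<delta> 0 = 0" by simp
  show "?\<delta> (x + (\<eta> - 1) * ?\<delta> x) = \<eta> * ?\<delta> x" if "\<eta> ^ n = 1" for \<eta> x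
  proof (cases "x ^ n = 1")
    case True
    have "x + (\<eta> - 1) * x = \<eta> * x" by (simp add: algebra_simps)
    then show ?thesis using True that by (simp add: power_mult_distrib)
  qed simp
  show "?\<delta> (h * x) = h * ?\<delta> x" if "h ^ n = 1" for h x
    using that by (simp add: power_mult_distrib)
  show "\<zeta> ^ n = 1" if "\<zeta> \<noteq> 0" and "\<And>x. ?\<delta> (\<zeta> * x) = \<zeta> * ?\<delta> x" for \<zeta>
    using that(2)[of 1] that(1) by (auto split: if_splits)
qed

text \<open>Since \<open>n dvd e\<close>, the \<open>n\<close>-th roots of unity permute the centres
  \<open>\<sigma> * s\<close> and preserve \<open>H\<close>, so \<open>\<delta>\<close> commutes
  with them. Hypothesis \<open>disj\<close> makes the translates disjoint, and
  \<open>(- s) ^ e \<noteq> 1\<close> keeps 0 outside them.\<close>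

lemma has_orthogonal_linear_translates:
  fixes g s :: "'a::{field,finite}"
  assumes g: "mult_generator g" and d: "d > 0" and n: "CARD('a) - 1 = n * d"
    and e: "e \<ge> 4" "e dvd CARD('a) - 1" "n dvd e"
    and s: "s \<noteq> 0" "(- s) ^ e \<noteq> 1"
    and disj: "\<And>\<sigma> h h'. \<sigma> ^ n = 1 \<Longrightarrow> \<sigma> \<noteq> 1 \<Longrightarrow> h ^ e = 1 \<Longrightarrow> h' ^ e = 1 \<Longrightarrow> (1 - \<sigma>) * s \<noteq> h - h'"
  shows "has_orthogonal_linear g d"
proof -
  \<comment> \<open>The choice is well defined by \<open>uniq\<close> below. The facts
    \<open>on\<close> and \<open>off\<close> replace this formula afterwards.\<close>
  define \<delta> where "\<delta> = (\<lambda>x. if \<exists>\<sigma>. \<sigma> ^ n = 1 \<and> (x - \<sigma> * s) ^ e = 1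
    then x - (SOME \<sigma>. \<sigma> ^ n = 1 \<and> (x - \<sigma> * s) ^ e = 1) * s else 0)"
  have e0: "e > 0" using e by simp
  have n0: "n > 0" using e by (auto intro: gr0I)
  have pe: "\<sigma> ^ e = 1" if "\<sigma> ^ n = 1" for \<sigma> :: 'a
    using e(3) that by (auto simp: power_mult)
  have nz: "\<sigma> \<noteq> 0" if "\<sigma> ^ e = 1" for \<sigma> :: 'a using that e0 by (auto simp: zero_power)
  have uniq: "\<sigma> = \<tau>" if \<sigma>: "\<sigma> ^ n = 1" "(x - \<sigma> * s) ^ e = 1" and \<tau>: "\<tau> ^ n = 1" "(x - \<tau> * s) ^ e = 1"
    for \<sigma> \<tau> x
  proof (rule ccontr)
    assume ne: "\<sigma> \<noteq> \<tau>"
    have \<sigma>0: "\<sigma> \<noteq> 0" using nz pe \<sigma> by blast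
    \<comment> \<open>Division by \<open>\<sigma>\<close> moves one of the two centres to
      \<open>s\<close> and keeps both displacements in \<open>H\<close>.\<close>
    have "(1 - \<tau> / \<sigma>) * s = (x - \<tau> * s) / \<sigma> - (x - \<sigma> * s) / \<sigma>"
      using \<sigma>0 by (simp add: field_simps)
    moreover have "(\<tau> / \<sigma>) ^ n = 1" "\<tau> / \<sigma> \<noteq> 1" using \<sigma> \<tau> ne \<sigma>0 by (auto simp: power_divide)
    moreover have "((x - \<tau> * s) / \<sigma>) ^ e = 1" "((x - \<sigma> * s) / \<sigma>) ^ e = 1"
      using \<sigma> \<tau> pe by (simp_all add: power_divide)
    ultimately show False using disj by blast
  qed
  have on: "\<delta> (\<sigma> * s + h) = h" if "\<sigma> ^ n = 1" "h ^ e = 1" for \<sigma> h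
  proof -
    have P: "\<sigma> ^ n = 1 \<and> (\<sigma> * s + h - \<sigma> * s) ^ e = 1" using that by simp
    have "(SOME \<tau>. \<tau> ^ n = 1 \<and> (\<sigma> * s + h - \<tau> * s) ^ e = 1) = \<sigma>"
      using P uniq by (intro some_equality) blast+
    then show ?thesis using P unfolding \<delta>_def by auto
  qed
  have off: "\<delta> x = 0" if "\<nexists>\<sigma> h. \<sigma> ^ n = 1 \<and> h ^ e = 1 \<and> x = \<sigma> * s + h" for x
  proof -
    have "\<nexists>\<sigma>. \<sigma> ^ n = 1 \<and> (x - \<sigma> * s) ^ e = 1"
    proof
      assume "\<exists>\<sigma>. \<sigma> ^ n = 1 \<and> (x - \<sigma> * s) ^ e = 1"
      then obtain \<sigma> where \<sigma>: "\<sigma> ^ n = 1" "(x - \<sigma> * s) ^ e = 1" by blast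
      moreover have "x = \<sigma> * s + (x - \<sigma> * s)" by simp
      ultimately show False using that by blast
    qed
    then show ?thesis unfolding \<delta>_def by (rule if_not_P)
  qed
  have com: "\<delta> (\<tau> * x) = \<tau> * \<delta> x" if \<tau>: "\<tau> ^ n = 1" for \<tau> x
  proof (cases "\<exists>\<sigma> h. \<sigma> ^ n = 1 \<and> h ^ e = 1 \<and> x = \<sigma> * s + h")
    case True
    then obtain \<sigma> h where *: "\<sigma> ^ n = 1" "h ^ e = 1" "x = \<sigma> * s + h" by blast
    have "\<tau> * x = (\<tau> * \<sigma>) * s + \<tau> * h" by (simp add: * algebra_simps)
    moreover have "\<delta> ((\<tau> * \<sigma>) * s + \<tau> * h) = \<tau> * h"
      using * \<tau> pe by (intro on) (simp_all add: power_mult_distrib)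
    ultimately show ?thesis using on[of \<sigma> h] * by simp
  next
    case False
    have \<tau>0: "\<tau> \<noteq> 0" using nz pe \<tau> by blast
    have "\<nexists>\<sigma> h. \<sigma> ^ n = 1 \<and> h ^ e = 1 \<and> \<tau> * x = \<sigma> * s + h"
    proof
      assume "\<exists>\<sigma> h. \<sigma> ^ n = 1 \<and> h ^ e = 1 \<and> \<tau> * x = \<sigma> * s + h"
      then obtain \<sigma> h where *: "\<sigma> ^ n = 1" "h ^ e = 1" "\<tau> * x = \<sigma> * s + h" by blast
      have "x = (\<tau> * x) / \<tau>" using \<tau>0 by simp
      then have "x = (\<sigma> / \<tau>) * s + h / \<tau>" by (simp add: * add_divide_distrib)
      moreover have "(\<sigma> / \<tau>) ^ n = 1" "(h / \<tau>) ^ e = 1" using * \<tau> pe by (simp_all add: power_divide)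
      ultimately show False using False by blast
    qed
    then show ?thesis using off False by simp
  qed
  show ?thesis
  proof (rule has_orthogonal_linear_patch[OF g d n e(1,2)])
    show "\<delta> 0 = 0"
    proof (rule off, rule notI)
      assume "\<exists>\<sigma> h. \<sigma> ^ n = 1 \<and> h ^ e = 1 \<and> 0 = \<sigma> * s + h"
      then obtain \<sigma> h where *: "\<sigma> ^ n = 1" "h ^ e = 1" "0 = \<sigma> * s + h" by blast
      have "\<sigma> \<noteq> 0" using nz pe * by blast
      then have "- s = h / \<sigma>" using *(3) by (simp add: nonzero_eq_divide_eq minus_unique mult.commute)
      then have "(- s) ^ e = 1" using * pe by (simp add: power_divide)
      then show False using s by blast
    qed
    show "\<delta> (x + (\<eta> - 1) * \<delta> x) = \<eta> * \<delta> x" if \<eta>: "\<eta> ^ e = 1" for \<eta> x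
    proof (cases "\<exists>\<sigma> h. \<sigma> ^ n = 1 \<and> h ^ e = 1 \<and> x = \<sigma> * s + h")
      case True
      then obtain \<sigma> h where *: "\<sigma> ^ n = 1" "h ^ e = 1" "x = \<sigma> * s + h" by blast
      then have "\<delta> x = h" using on by simp
      then have eq: "x + (\<eta> - 1) * \<delta> x = \<sigma> * s + \<eta> * h" by (simp add: * algebra_simps)
      have "\<delta> (\<sigma> * s + \<eta> * h) = \<eta> * h"
        using * \<eta> by (intro on) (simp_all add: power_mult_distrib)
      then show ?thesis unfolding eq by (simp add: \<open>\<delta> x = h\<close>)
    qed (simp add: off)
    show "\<delta> (h * x) = h * \<delta> x" if "h ^ n = 1" for h x using com that .
    show "\<zeta> ^ n = 1" if \<zeta>: "\<zeta> \<noteq> 0" and c: "\<And>x. \<delta> (\<zeta> * x) = \<zeta> * \<delta> x" for \<zeta>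
    proof -
      \<comment> \<open>The point \<open>s + 1\<close> has displacement 1, so its image under
        \<open>\<zeta>\<close> must have displacement \<open>\<zeta>\<close> from some centre
        \<open>\<sigma> * s\<close>. Comparing the two forms of the image gives
        \<open>\<zeta> = \<sigma>\<close>.\<close>
      have d1: "\<delta> (s + 1) = 1" using on[of 1 1] by simp
      then have dz: "\<delta> (\<zeta> * (s + 1)) = \<zeta>" using c by simp
      then obtain \<sigma> h where *: "\<sigma> ^ n = 1" "h ^ e = 1" "\<zeta> * (s + 1) = \<sigma> * s + h"
        using off \<zeta> by metis
      then have "h = \<zeta>" using on dz by metis
      then have "\<zeta> = \<sigma>" using * s by (simp add: algebra_simps)
      then show ?thesis using * by simp
    qed
  qed
qed

text \<open>Every difference is \<open>(1 - \<zeta> ^ j) * h\<close> for a generator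
  \<open>\<zeta>\<close> of the group. Because \<open>e\<close> is even, -1 belongs to the group,
  and \<open>1 - \<zeta> ^ j = - (\<zeta> ^ j) * (1 - \<zeta> ^ (e - j))\<close> shows that
  \<open>j\<close> and \<open>e - j\<close> give the same coset. Half of the exponents therefore
  suffice.\<close>

lemma card_differences_roots_of_unity:
  fixes g :: "'a::{field,finite}"
  assumes g: "mult_generator g" and e: "e dvd CARD('a) - 1" "even e"
  shows "card {h - h' | h h' :: 'a. h ^ e = 1 \<and> h' ^ e = 1} \<le> 1 + e * (e div 2)"
proof -
  let ?H = "{h :: 'a. h ^ e = 1}"
  define \<zeta> where "\<zeta> = g ^ ((CARD('a) - 1) div e)"
  define E where "E = (\<Union>j\<in>{1..e div 2}. (\<lambda>h. (1 - \<zeta> ^ j) * h) ` ?H)"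
  have H: "?H = (\<lambda>j. \<zeta> ^ j) ` {..<e}" and cH: "card ?H = e"
    using card_roots_of_unity[OF g e(1)] by (simp_all add: \<zeta>_def)
  have e0: "e > 0" using e(1) card_field_gt_1[where 'a='a] by (auto intro: gr0I)
  have \<zeta>: "\<zeta> ^ e = 1" using e by (simp add: \<zeta>_def mult_generator_power_eq_1_iff[OF g] flip: power_mult)
  have sub: "h - h' \<in> insert 0 E" if h: "h ^ e = 1" "h' ^ e = 1" for h h' :: 'a
  proof -
    have h0: "h \<noteq> 0" using h e0 by (auto simp: zero_power)
    have "h' / h \<in> ?H" using h by (simp add: power_divide)
    then obtain j where j: "j < e" "h' / h = \<zeta> ^ j" using H by auto
    then have eq: "h - h' = (1 - \<zeta> ^ j) * h" using h0 by (simp add: field_simps)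
    consider "j = 0" | "j \<in> {1..e div 2}" | "j > e div 2" by force
    then show ?thesis
    proof cases
      case 2
      then show ?thesis using eq h unfolding E_def by blast
    next
      case 3
      then have k: "e - j \<in> {1..e div 2}" using j by auto
      have "\<zeta> ^ j * \<zeta> ^ (e - j) = 1" using j \<zeta> by (simp flip: power_add)
      then have "h - h' = (1 - \<zeta> ^ (e - j)) * (- (\<zeta> ^ j) * h)" by (simp add: eq algebra_simps)
      moreover have "(- (\<zeta> ^ j) * h) ^ e = 1"
      proof -
        have "(\<zeta> ^ j) ^ e = 1" by (metis \<zeta> power_mult mult.commute power_one)
        then show ?thesis using h e by (simp add: power_mult_distrib)
      qed
      ultimately show ?thesis using k unfolding E_def by blast
    qed (simp add: eq)
  qed
  have "card {h - h' | h h' :: 'a. h ^ e = 1 \<and> h' ^ e = 1} \<le> card (insert 0 E)"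
    by (rule card_mono[OF finite]) (use sub in blast)
  also have "\<dots> \<le> 1 + card E" by (simp add: card_insert_if)
  also have "card E \<le> (\<Sum>j\<in>{1..e div 2}. card ((\<lambda>h. (1 - \<zeta> ^ j) * h) ` ?H))"
    unfolding E_def by (rule card_UN_le) simp
  also have "\<dots> \<le> (\<Sum>j\<in>{1..e div 2}. e)"
    using cH by (intro sum_mono) (metis card_image_le finite)
  finally show ?thesis by (simp add: mult.commute)
qed

text \<open>The bound on q leaves an element \<open>y\<close> outside the set \<open>D\<close> of
  differences. \<open>D\<close> is closed under multiplication by \<open>H\<close> and under
  negation, so the single condition on \<open>y\<close> separates all the translates.\<close>

lemma has_orthogonal_linear_even_subgroup:
  fixes g :: "'a::{field,finite}"
  assumes g: "mult_generator g" and d: "d > 0" and n: "CARD('a) - 1 = n * d" "n \<in> {2, 3}"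
    and e: "e \<ge> 4" "e dvd CARD('a) - 1" "even e" "n dvd e"
    and q: "CARD('a) > 1 + e * (e div 2)"
  shows "has_orthogonal_linear g d"
proof -
  define D where "D = {h - h' | h h' :: 'a. h ^ e = 1 \<and> h' ^ e = 1}"
  have D: "h - h' \<in> D" if "h ^ e = 1" "h' ^ e = 1" for h h' using that unfolding D_def by blast
  have "card D < CARD('a)"
    using card_differences_roots_of_unity[OF g e(2,3)] q by (simp add: D_def)
  then obtain y where y: "y \<notin> D" by (metis UNIV_eq_I less_irrefl)
  have y0: "y \<noteq> 0" using D[of 1 1] y by auto
  define \<omega> where "\<omega> = g ^ ((CARD('a) - 1) div n)"
  have roots: "{h :: 'a. h ^ n = 1} = (\<lambda>j. \<omega> ^ j) ` {..<n}" "card {h :: 'a. h ^ n = 1} = n"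
    using card_roots_of_unity[OF g, of n] n(1) by (simp_all add: \<omega>_def)
  \<comment> \<open>This form serves \<open>n = 2\<close> and \<open>n = 3\<close> together: the
    nontrivial roots are \<open>\<omega>\<close> and its inverse.\<close>
  have "{..<n} = {0, 1, n - 1}" using n(2) by auto
  then have R: "{h :: 'a. h ^ n = 1} = {1, \<omega>, \<omega> ^ (n - 1)}" using roots(1) by simp
  have \<omega>n: "\<omega> ^ n = 1" using R by blast
  have \<omega>1: "\<omega> \<noteq> 1" using R roots(2) n(2) by auto
  have inv: "\<omega> ^ (n - 1) * \<omega> = 1" using \<omega>n n(2)
    by (metis insertE numeral_eq_Suc power_minus_mult singletonD zero_less_Suc)
  have \<omega>e: "\<omega> ^ e = 1" using \<omega>n e(4) by (auto simp: power_mult)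
  \<comment> \<open>The centres \<open>s\<close> and \<open>\<omega> * s\<close> then differ by
    exactly \<open>y\<close>.\<close>
  define s where "s = y / (1 - \<omega>)"
  have sy: "(1 - \<omega>) * s = y" using \<omega>1 by (simp add: s_def)
  show ?thesis
  proof (rule has_orthogonal_linear_translates[OF g d n(1) e(1,2,4), of s])
    show "s \<noteq> 0" using sy y0 by auto
    show "(- s) ^ e \<noteq> 1"
    proof
      assume "(- s) ^ e = 1"
      then have "s ^ e = 1" using e(3) by simp
      then have "s - \<omega> * s \<in> D" using \<omega>e by (intro D) (simp_all add: power_mult_distrib)
      moreover have "s - \<omega> * s = y" using sy by (simp add: algebra_simps)
      ultimately show False using y by simp
    qed
    fix \<sigma> h h' :: 'a
    assume \<sigma>: "\<sigma> ^ n = 1" "\<sigma> \<noteq> 1" and h: "h ^ e = 1" "h' ^ e = 1"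
    show "(1 - \<sigma>) * s \<noteq> h - h'"
    proof
      assume eq: "(1 - \<sigma>) * s = h - h'"
      from \<sigma> R have "\<sigma> = \<omega> \<or> \<sigma> = \<omega> ^ (n - 1)" by blast
      then show False
      proof
        assume "\<sigma> = \<omega>"
        then show False using eq sy D[OF h] y by simp
      next
        assume "\<sigma> = \<omega> ^ (n - 1)"
        then have "\<omega> * \<sigma> = 1" using inv by (simp add: mult.commute)
        then have "y = (\<omega> * \<sigma> - \<omega>) * s" using sy by simp
        also have "\<dots> = - \<omega> * ((1 - \<sigma>) * s)" by (simp add: algebra_simps)
        also have "\<dots> = \<omega> * h' - \<omega> * h" unfolding eq by (simp add: algebra_simps)
        also have "\<dots> \<in> D" using h \<omega>e by (intro D) (simp_all add: power_mult_distrib)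
        finally show False using y by simp
      qed
    qed
  qed
qed

text \<open>With one centre only, disjointness is vacuous. \<open>H\<close> is the group of nonzero
  squares, and the centre \<open>- g\<close> works because the generator is not a square.\<close>

lemma has_orthogonal_linear_n_1_odd:
  fixes g :: "'a::{field,finite}"
  assumes g: "mult_generator g" and q: "CARD('a) \<ge> 9" "odd CARD('a)"
  shows "has_orthogonal_linear g (CARD('a) - 1)"
proof -
  obtain e where e: "CARD('a) - 1 = 2 * e" using q(2) odd_two_times_div_two_nat by metis
  show ?thesis
  proof (rule has_orthogonal_linear_translates[OF g, of _ 1 e "- g"])
    show "(- (- g)) ^ e \<noteq> 1" using e q by (auto simp: mult_generator_power_eq_1_iff[OF g] dest!: dvd_imp_le)
  qed (use e q mult_generator_nonzero[OF g] in auto)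
qed

text \<open>The map \<open>a * x + b * x ^ Suc n\<close> is additive, so injectivity after
  subtracting \<open>t * x\<close> is triviality of the kernel, which is what \<open>nonroot\<close>
  states.\<close>

lemma has_orthogonal_linear_additive:
  fixes g a b c :: "'a::{field,finite}"
  assumes g: "mult_generator g" and d: "d > 0" and n: "CARD('a) - 1 = n * d"
    and c: "c \<noteq> 0" "c \<noteq> 1"
    and add: "\<And>x y :: 'a. (x + y) ^ Suc n = x ^ Suc n + y ^ Suc n"
    and nonroot: "\<And>t x. t \<in> {0, 1, c} \<Longrightarrow> x \<noteq> 0 \<Longrightarrow> b * x ^ n \<noteq> t - a"
    and b: "b \<noteq> 0"
  shows "has_orthogonal_linear g d"
proof -
  define \<theta> where "\<theta> = (\<lambda>x. a * x + b * x ^ Suc n)"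
  show ?thesis
  proof (rule has_orthogonal_linearI[where \<theta> = \<theta> and c = c, OF g d n c])
    fix t assume t: "t \<in> {0, 1, c}"
    show "inj (\<lambda>x. \<theta> x - t * x)"
    proof (rule injI)
      fix x y assume eq: "\<theta> x - t * x = \<theta> y - t * y"
      have diff: "(x - y) ^ Suc n = x ^ Suc n - y ^ Suc n" using add[of "x - y" y] by simp
      have "(x - y) * (a - t + b * (x - y) ^ n) = (a - t) * (x - y) + b * (x - y) ^ Suc n"
        by (simp add: algebra_simps)
      also have "\<dots> = (\<theta> x - t * x) - (\<theta> y - t * y)"
        unfolding diff \<theta>_def by (simp add: algebra_simps)
      finally have "(x - y) * (a - t + b * (x - y) ^ n) = 0" using eq by simp
      moreover have "a - t + b * (x - y) ^ n \<noteq> 0" if "x - y \<noteq> 0"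
        using nonroot[OF t that] by (auto simp: algebra_simps add_eq_0_iff)
      ultimately show "x = y" by auto
    qed
  next
    fix h x :: 'a assume "h ^ n = 1"
    then show "\<theta> (h * x) = h * \<theta> x" by (simp add: \<theta>_def power_mult_distrib algebra_simps)
  next
    fix \<zeta> :: 'a assume "\<zeta> \<noteq> 0" and com: "\<And>x. \<theta> (\<zeta> * x) = \<zeta> * \<theta> x"
    then show "\<zeta> ^ n = 1" using com[of 1] b by (simp add: \<theta>_def algebra_simps)
  qed (simp add: \<theta>_def)
qed

subsection \<open>Additive maps in characteristics 2 and 3\<close>

text \<open>The additive group has a subgroup of order \<open>r\<close>, and a nonzero
  \<open>h\<close> in it satisfies \<open>of_nat r * h = 0\<close>.\<close>

lemma prime_dvd_CARD_imp_of_nat_eq_0: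
  assumes "prime r" "r dvd CARD('a::{field,finite})"
  shows "of_nat r = (0 :: 'a)"
proof -
  define G :: "'a monoid" where "G = \<lparr>carrier = UNIV, monoid.mult = (+), one = 0\<rparr>"
  have "x \<in> Units G" for x
    by (auto simp: G_def Units_def intro!: exI[of _ "- x"])
  then have G: "group G"
    by (intro group.intro group_axioms.intro monoid.intro) (auto simp: G_def algebra_simps)
  obtain m where "CARD('a) = r * m" using assms by blast
  then obtain H where H: "subgroup H G" "card H = r"
    using sylow_thm[OF assms(1) G, of 1 m] by (auto simp: G_def order_def)
  define K where "K = G\<lparr>carrier := H\<rparr>"
  have K: "group K" using subgroup.subgroup_is_group[OF H(1) G] by (simp add: K_def)
  have pow: "x [^]\<^bsub>K\<^esub> k = of_nat k * x" for x and k :: nat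
    by (induction k) (simp_all add: nat_pow_def K_def G_def algebra_simps)
  have "\<not> H \<subseteq> {0}"
  proof
    assume "H \<subseteq> {0}"
    then have "card H \<le> card {0 :: 'a}" by (intro card_mono) auto
    then show False using H(2) prime_gt_1_nat[OF assms(1)] by simp
  qed
  then obtain h where h: "h \<in> H" "h \<noteq> 0" by blast
  have "h [^]\<^bsub>K\<^esub> order K = \<one>\<^bsub>K\<^esub>"
    using h by (intro group.pow_order_eq_1[OF K]) (auto simp: K_def)
  then have "of_nat r * h = 0" using H(2) by (simp add: pow) (simp add: K_def G_def order_def)
  then show ?thesis using h by simp
qed

text \<open>The characteristic divides both primes and is not 1. Orders that are not prime powers
  are excluded with this later.\<close>

lemma prime_dvd_CARD_unique:
  assumes "prime p" "p dvd CARD('a::{field,finite})" "prime r" "r dvd CARD('a)"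
  shows "p = r"
proof -
  have "CHAR('a) dvd p" "CHAR('a) dvd r"
    using prime_dvd_CARD_imp_of_nat_eq_0[where 'a='a] assms
    by (auto simp flip: of_nat_eq_0_iff_char_dvd)
  then show ?thesis using assms(1,3) CHAR_not_1[where 'a='a] by (metis One_nat_def prime_nat_iff)
qed

text \<open>Cubing is additive here. With \<open>b = - g\<close> for the nonsquare \<open>g\<close>,
  the kernels are trivial once \<open>a\<close>, \<open>a - 1\<close> and \<open>a - c\<close> are
  all squares.\<close>

lemma has_orthogonal_linear_n_2_char_3:
  fixes g :: "'a::{field,finite}"
  assumes g: "mult_generator g" and d: "d > 0" and n: "CARD('a) - 1 = 2 * d"
    and ch: "(3 :: 'a) = 0" and q: "CARD('a) \<ge> 9"
  shows "has_orthogonal_linear g d"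
proof -
  have g0: "g \<noteq> 0" by (rule mult_generator_nonzero[OF g])
  have nonsquare: "g \<noteq> z ^ 2" for z
  proof
    assume z: "g = z ^ 2"
    then have "g ^ d = z ^ (CARD('a) - 1)" by (simp only: n power_mult)
    also have "\<dots> = 1" using z g0 by (intro finite_field_power_card_minus_1) auto
    finally have "CARD('a) - 1 dvd d" using mult_generator_power_eq_1_iff[OF g] by simp
    then show False using n d by (auto dest: dvd_imp_le)
  qed
  \<comment> \<open>The squares of \<open>g + 1 / g\<close> and \<open>g - 1 / g\<close> differ by
    4, which is 1 in characteristic 3.\<close>
  define a where "a = (g + 1 / g) ^ 2"
  have "a = (g - 1 / g) ^ 2 + 3 + 1"
    using g0 by (simp add: a_def power2_eq_square field_simps)
  then have a1: "a - 1 = (g - 1 / g) ^ 2" using ch by simp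
  have ne: "g ^ k \<noteq> 1" if "k \<in> {2, 4}" for k
  proof
    assume "g ^ k = 1"
    then have "CARD('a) - 1 dvd k" by (simp add: mult_generator_power_eq_1_iff[OF g])
    then show False using that q by (auto dest!: dvd_imp_le)
  qed
  have "card {1, g ^ 2, g ^ 4} = 3"
  proof -
    have "g ^ 4 \<noteq> g ^ 2"
    proof
      assume eq: "g ^ 4 = g ^ 2"
      have "g ^ 2 * g ^ 2 = g ^ 4" by (simp flip: power_add)
      also note eq
      also have "g ^ 2 = g ^ 2 * 1" by simp
      finally have "g ^ 2 = 1" unfolding mult_cancel_left using g0 by auto
      then show False using ne[of 2] by simp
    qed
    then show ?thesis using ne[of 2] ne[of 4] by auto
  qed
  moreover have "card {a, a - 1} \<le> 2" by (simp add: card_insert_if)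
  ultimately have "\<not> {1, g ^ 2, g ^ 4} \<subseteq> {a, a - 1}"
    using card_mono[of "{a, a - 1}" "{1, g ^ 2, g ^ 4}"] by auto
  then obtain r where r: "r \<in> {1, g ^ 2, g ^ 4}" "r \<noteq> a" "r \<noteq> a - 1" by blast
  have "1 = (1 :: 'a) ^ 2" "g ^ 4 = (g ^ 2) ^ 2" by simp (simp flip: power_mult)
  with r(1) obtain y where "r = y ^ 2" by blast
  with r(2,3) have y: "y ^ 2 \<noteq> a" "y ^ 2 \<noteq> a - 1" by auto
  \<comment> \<open>This makes \<open>a - c\<close> a square; \<open>y ^ 2\<close> was taken from
    three distinct squares so as to avoid \<open>c = 0\<close> and \<open>c = 1\<close>.\<close>
  define c where "c = a - y ^ 2"
  show ?thesis
  proof (rule has_orthogonal_linear_additive[OF g d n, of c "- g" a])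
    show "c \<noteq> 0" "c \<noteq> 1" using y by (auto simp: c_def algebra_simps)
    show "- g \<noteq> 0" using g0 by simp
    show "(u + v) ^ Suc 2 = u ^ Suc 2 + v ^ Suc 2" for u v :: 'a
    proof -
      have "(u + v) ^ Suc 2 = u ^ Suc 2 + v ^ Suc 2 + 3 * (u * v * (u + v))"
        unfolding power_Suc power2_eq_square by (simp add: algebra_simps)
      then show ?thesis using ch by simp
    qed
    fix t x :: 'a assume t: "t \<in> {0, 1, c}" and x: "x \<noteq> 0"
    have "\<exists>w. a - t = w ^ 2" using t a1 by (auto simp: a_def c_def)
    then obtain w where w: "a - t = w ^ 2" by blast
    show "- g * x ^ 2 \<noteq> t - a"
    proof
      assume "- g * x ^ 2 = t - a"
      then have "- (g * x ^ 2) = - (a - t)" by simp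
      then have "g * x ^ 2 = w ^ 2" unfolding w neg_equal_iff_equal .
      then have "g = (w / x) ^ 2" using x by (simp add: power_divide field_simps)
      then show False using nonsquare by blast
    qed
  qed
qed

text \<open>The fourth power is additive here, and \<open>C\<close> is the group of nonzero cubes.
  The kernels are trivial if no \<open>t - a\<close> lies in the coset of \<open>b\<close> modulo
  cubes.\<close>

lemma has_orthogonal_linear_n_3_char_2:
  fixes g :: "'a::{field,finite}"
  assumes g: "mult_generator g" and d: "d \<ge> 3" and n: "CARD('a) - 1 = 3 * d"
    and ch: "(2 :: 'a) = 0"
  shows "has_orthogonal_linear g d"
proof -
  define C where "C = {h :: 'a. h ^ d = 1}"
  have cC: "card C = d" unfolding C_def using n by (intro card_roots_of_unity[OF g]) simp
  have cube: "h / x ^ 3 \<in> C" if "h \<in> C" "x \<noteq> 0" for h x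
    using that finite_field_power_card_minus_1[of x] n
    by (simp add: C_def power_divide flip: power_mult)
  define a where "a = g"
  have a0: "a \<noteq> 0" using mult_generator_nonzero[OF g] by (simp add: a_def)
  let ?A = "\<lambda>w. (\<lambda>h. w * h) ` C"
  \<comment> \<open>Zero and two cosets of \<open>C\<close> have at most 2 d + 1 elements, fewer
    than q = 3 d + 1, so a nonzero \<open>b\<close> outside both cosets exists.\<close>
  have "card (insert 0 (?A (- a) \<union> ?A (1 - a))) \<le> 1 + (d + d)"
  proof -
    have "card (?A w) \<le> d" for w using cC card_image_le[of C] by auto
    then have "card (?A (- a) \<union> ?A (1 - a)) \<le> d + d" by (meson add_mono card_Un_le le_trans)
    then show ?thesis by (simp add: card_insert_if)
  qed
  also have "\<dots> < CARD('a)" using n d by simp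
  finally obtain b where b: "b \<notin> insert 0 (?A (- a) \<union> ?A (1 - a))"
    by (metis UNIV_eq_I less_irrefl)
  have "\<not> C \<subseteq> {1, 1 - 1 / a}"
  proof
    assume "C \<subseteq> {1, 1 - 1 / a}"
    then have "card C \<le> card {1, 1 - 1 / a}" by (intro card_mono) auto
    also have "\<dots> \<le> 2" by (simp add: card_insert_if)
    finally show False using cC d by simp
  qed
  then obtain h where h: "h \<in> C" "h \<noteq> 1" "h \<noteq> 1 - 1 / a" by blast
  \<comment> \<open>Now \<open>c - a = - a * h\<close> lies in the coset of \<open>- a\<close>, so
    \<open>t = c\<close> imposes no condition beyond that of \<open>t = 0\<close>.\<close>
  define c where "c = a - a * h"
  show ?thesis
  proof (rule has_orthogonal_linear_additive[OF g _ n, of c b a])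
    show "d > 0" using d by simp
    show "c \<noteq> 0" using h a0 by (simp add: c_def)
    show "c \<noteq> 1" using h a0 by (auto simp: c_def field_simps)
    show "b \<noteq> 0" using b by simp
    show "(u + v) ^ Suc 3 = u ^ Suc 3 + v ^ Suc 3" for u v :: 'a
    proof -
      have "(u + v) ^ Suc 3 = u ^ Suc 3 + v ^ Suc 3 + 2 * (u * v * (2 * u ^ 2 + 3 * u * v + 2 * v ^ 2))"
        unfolding power_Suc power3_eq_cube power2_eq_square by (simp add: algebra_simps)
      then show ?thesis using ch by simp
    qed
    fix t x :: 'a assume t: "t \<in> {0, 1, c}" and x: "x \<noteq> 0"
    have "1 \<in> C" by (simp add: C_def)
    have "\<exists>w\<in>{- a, 1 - a}. \<exists>k\<in>C. t - a = w * k"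
      using t h(1) \<open>1 \<in> C\<close> by (auto simp: c_def)
    then obtain w k where w: "w \<in> {- a, 1 - a}" "k \<in> C" "t - a = w * k" by blast
    show "b * x ^ 3 \<noteq> t - a"
    proof
      assume "b * x ^ 3 = t - a"
      then have "b = w * (k / x ^ 3)" using w x by (simp add: field_simps)
      then show False using b w cube[of k x] x by blast
    qed
  qed
qed

text \<open>\<open>V\<close> is a proper additive subgroup, since \<open>f\<close> is additive with
  \<open>f 0 = f 1\<close>. If \<open>b = (a + t) * v\<close> with \<open>v\<close> in
  \<open>V\<close>, then subtracting \<open>t * x\<close> leaves \<open>a + t\<close> times a map
  that adds \<open>v\<close> outside \<open>V\<close>; this map preserves \<open>V\<close> and its
  complement.\<close>

lemma has_orthogonal_linear_n_1_even:
  fixes g :: "'a::{field,finite}"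
  assumes g: "mult_generator g" and ch: "(2 :: 'a) = 0" and q: "CARD('a) \<ge> 8"
  shows "has_orthogonal_linear g (CARD('a) - 1)"
proof -
  define f where "f = (\<lambda>v :: 'a. v ^ 2 + v)"
  define V where "V = range f"
  have dbl: "x + x = 0" for x :: 'a using ch by (metis mult_2 mult_zero_left)
  have neg: "- x = x" for x :: 'a using dbl[of x] by (simp add: minus_unique)
  have minus: "x - y = x + y" for x y :: 'a using neg[of y] by (metis diff_conv_add_uminus)
  have f_add: "f x + f y = f (x + y)" for x y
  proof -
    have "f (x + y) = f x + f y + 2 * (x * y)"
      by (simp add: f_def power2_eq_square algebra_simps)
    then show ?thesis using ch by simp
  qed
  have V_add: "x + y \<in> V" if "x \<in> V" "y \<in> V" for x y
    using that f_add unfolding V_def by fastforce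
  have V_add_iff: "x + v \<in> V \<longleftrightarrow> x \<in> V" if "v \<in> V" for x v
    using V_add[of "x + v" v] V_add[of x v] that dbl[of v] by (auto simp: add.assoc)
  have f0: "f x \<noteq> 0" if "x \<noteq> 0" "x \<noteq> 1" for x
  proof
    assume "f x = 0"
    then have "x * (x + 1) = 0" by (simp add: f_def power2_eq_square algebra_simps)
    then have "x + 1 = 0" using that by simp
    then show False using that neg[of x] by (simp add: add_eq_0_iff)
  qed
  have "f 0 = f 1" using dbl[of 1] by (simp add: f_def)
  then have "\<not> inj f" by (metis injD zero_neq_one)
  then have "V \<noteq> UNIV" using finite_UNIV_surj_inj[OF finite] by (auto simp: V_def)
  then obtain x0 where x0: "x0 \<notin> V" by blast
  have g01: "g \<noteq> 0" "g \<noteq> 1"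
    using mult_generator_nonzero[OF g] mult_generator_power_eq_1_iff[OF g, of 1] q by auto
  \<comment> \<open>The excluded values keep \<open>z\<close>, \<open>w\<close> and
    \<open>y = z + w\<close> away from 0 and 1, the only zeros of \<open>f\<close>.\<close>
  define z where "z = g"
  have "card {0, 1, z, z + 1} \<le> 4" by (simp add: card_insert_if)
  then have "{0, 1, z, z + 1} \<noteq> UNIV" using q by auto
  then obtain w where w: "w \<notin> {0, 1, z, z + 1}" by blast
  define y where "y = z + w"
  \<comment> \<open>\<open>a\<close> and \<open>b\<close> are solved from \<open>b / a = f y\<close> and \<open>b / (a + 1) = f z\<close>. The choice \<open>c = a\<^sup>2\<close>
    makes \<open>b / (a + c)\<close> the sum of these two elements of \<open>V\<close>.\<close>
  have "w = z + y" using dbl[of z] by (simp add: y_def flip: add.assoc)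
  then have y01: "y \<noteq> 0" "y \<noteq> 1" using w by auto
  have fy: "f y = f z + f w" by (simp add: f_add y_def)
  have fz: "f z \<noteq> 0" and fw: "f w \<noteq> 0" and fy0: "f y \<noteq> 0"
    using f0 w g01 y01 by (auto simp: z_def)
  define a where "a = f z / f w"
  define b where "b = a * f y"
  define c where "c = a ^ 2"
  have aw: "a * f w = f z" using fw by (simp add: a_def)
  have a0: "a \<noteq> 0" using fz fw by (simp add: a_def)
  have a1: "a \<noteq> 1"
  proof
    assume "a = 1"
    then have "f y = 0" using aw fy dbl by simp
    then show False using fy0 by simp
  qed
  have b0: "b \<noteq> 0" using a0 fy0 by (simp add: b_def)
  have b1: "b = (a + 1) * f z" using aw fy by (simp add: b_def algebra_simps)
  have b2: "b = (a + a ^ 2) * f w"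
  proof -
    have "(a + a ^ 2) * f w = (1 + a) * (a * f w)" by (simp add: power2_eq_square algebra_simps)
    then show ?thesis using aw b1 by (simp add: add.commute)
  qed
  have bv: "\<exists>v\<in>V. b = (a + t) * v \<and> a + t \<noteq> 0" if t: "t \<in> {0, 1, c}" for t
  proof -
    have "\<exists>v. b = (a + t) * f v"
    proof -
      from t consider "t = 0" | "t = 1" | "t = a ^ 2" by (auto simp: c_def)
      then show ?thesis
      proof cases
        case 1
        then show ?thesis by (auto simp: b_def)
      qed (use b1 b2 in blast)+
    qed
    then have "\<exists>v\<in>V. b = (a + t) * v" by (auto simp: V_def)
    then show ?thesis using b0 by auto
  qed
  define \<theta> where "\<theta> = (\<lambda>x. a * x + (if x \<in> V then 0 else b))"
  show ?thesis
  proof (rule has_orthogonal_linearI[where n = 1 and c = c and \<theta> = \<theta>, OF g])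
    show "CARD('a) - 1 > 0" using q by simp
    show "c \<noteq> 0" using a0 by (simp add: c_def)
    show "c \<noteq> 1" using a1 neg[of 1] by (auto simp: c_def power2_eq_1_iff)
    show "\<theta> 0 = 0"
    proof -
      have "f 0 = 0" by (simp add: f_def)
      then have "0 \<in> V" by (metis V_def rangeI)
      then show ?thesis by (simp add: \<theta>_def)
    qed
    fix t assume t: "t \<in> {0, 1, c}"
    obtain v where v: "v \<in> V" "b = (a + t) * v" "a + t \<noteq> 0" using bv[OF t] by blast
    have rw: "\<theta> x - t * x = (a + t) * (x + (if x \<in> V then 0 else v))" for x
      by (simp add: \<theta>_def minus v(2) algebra_simps)
    show "inj (\<lambda>x. \<theta> x - t * x)"
    proof (rule injI)
      fix x x' assume "\<theta> x - t * x = \<theta> x' - t * x'"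
      then have eq: "x + (if x \<in> V then 0 else v) = x' + (if x' \<in> V then 0 else v)"
        using v(3) by (simp add: rw)
      have "x + (if x \<in> V then 0 else v) \<in> V \<longleftrightarrow> x \<in> V" for x
        using V_add_iff[OF v(1)] by simp
      then have "x \<in> V \<longleftrightarrow> x' \<in> V" using eq by metis
      then show "x = x'" using eq by (simp split: if_splits)
    qed
  next
    fix \<zeta> assume "\<zeta> \<noteq> 0" and com: "\<And>x. \<theta> (\<zeta> * x) = \<zeta> * \<theta> x"
    \<comment> \<open>At the point \<open>x0\<close> outside \<open>V\<close> the added term is
      \<open>b\<close>. The term added at \<open>\<zeta> * x0\<close> is thus
      \<open>\<zeta> * b\<close>, and it can only be 0 or \<open>b\<close>.\<close>
    have "\<theta> (\<zeta> * x0) = a * \<zeta> * x0 + \<zeta> * b" using com[of x0] x0 by (simp add: \<theta>_def algebra_simps)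
    then have "\<zeta> * b = 0 \<or> \<zeta> * b = b" by (auto simp: \<theta>_def algebra_simps split: if_splits)
    then show "\<zeta> ^ 1 = 1" using \<open>\<zeta> \<noteq> 0\<close> b0 by auto
  qed simp_all
qed

subsection \<open>Prime fields\<close>

locale prime_order_field =
  fixes g :: "'a::{field,finite}" and p :: int
  assumes g: "mult_generator g" and p: "p = int CARD('a)" and prime: "prime CARD('a)"
begin

lemma of_int_eq_iff_mod: "of_int x = (of_int y :: 'a) \<longleftrightarrow> x mod p = y mod p"
proof -
  have "CHAR('a) = CARD('a)"
    using CHAR_dvd_CARD[where 'a='a] CHAR_not_1[where 'a='a] prime
    by (metis One_nat_def prime_nat_iff)
  then show ?thesis by (simp add: of_int_eq_iff_cong_CHAR cong_def p)
qed

lemma p_gt_1: "p > 1"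
  using prime_gt_1_nat[OF prime] by (simp add: p)

lemma of_int_mod [simp]: "of_int (x mod p) = (of_int x :: 'a)"
  by (simp add: of_int_eq_iff_mod)

definition residue :: "'a \<Rightarrow> int" where
  "residue x = (THE i. i \<in> {0..<p} \<and> of_int i = x)"

lemma residue: "residue x \<in> {0..<p}" "of_int (residue x) = x"
proof -
  have inj: "inj_on (of_int :: int \<Rightarrow> 'a) {0..<p}"
    by (rule inj_onI) (simp add: of_int_eq_iff_mod)
  then have "card ((of_int :: int \<Rightarrow> 'a) ` {0..<p}) = CARD('a)"
    by (simp add: card_image p)
  then have "(of_int :: int \<Rightarrow> 'a) ` {0..<p} = UNIV"
    by (intro card_subset_eq) auto
  then obtain i where i: "i \<in> {0..<p}" "of_int i = x" by (metis UNIV_I imageE)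
  then have "\<exists>!i. i \<in> {0..<p} \<and> of_int i = x" using inj unfolding inj_on_def by blast
  then have "residue x \<in> {0..<p} \<and> of_int (residue x) = x"
    unfolding residue_def by (rule theI')
  then show "residue x \<in> {0..<p}" "of_int (residue x) = x" by auto
qed

lemma residue_of_int: "residue (of_int i) = i mod p"
proof -
  have "residue (of_int i) mod p = i mod p"
    using residue(2)[of "of_int i"] by (simp add: of_int_eq_iff_mod)
  then show ?thesis using residue(1)[of "of_int i"] by simp
qed

lemma residue_0 [simp]: "residue 0 = 0"
  using residue_of_int[of 0] by simp

end

section \<open>Explicit maps verified by computation\<close>

definition orbit_table :: "int \<Rightarrow> int list \<Rightarrow> (int \<times> int) list \<Rightarrow> (int \<times> int) list" where
  "orbit_table p hs ps = concat (map (\<lambda>(x, v). map (\<lambda>h. (h * x mod p, h * v mod p)) hs) ps)"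

definition patched_linear :: "int \<Rightarrow> (int \<times> int) list \<Rightarrow> int \<Rightarrow> int" where
  "patched_linear a ps x = (case map_of ps x of None \<Rightarrow> a * x | Some v \<Rightarrow> v)"

text \<open>An executable form of the hypotheses of \<open>has_orthogonal_linearI\<close> on
  residues. The equivalence in the last conjunct covers both commutation with the
  \<open>n\<close>-th roots of unity and minimality of the index.\<close>

definition certificate :: "int \<Rightarrow> nat \<Rightarrow> int \<Rightarrow> (int \<Rightarrow> int) \<Rightarrow> bool" where
  "certificate p n c f \<longleftrightarrow> 1 < c \<and> c < p \<and> f 0 = 0 \<and>
    list_all (\<lambda>t. distinct (map (\<lambda>x. (f x - t * x) mod p) [0..p - 1])) [0, 1, c] \<and>
    list_all (\<lambda>z. (z ^ n mod p = 1) =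
      list_all (\<lambda>x. f (z * x mod p) mod p = z * f x mod p) [0..p - 1]) [1..p - 1]"

lemma (in prime_order_field) has_orthogonal_linear_certificate:
  assumes d: "d > 0" and n: "CARD('a) - 1 = n * d" and cert: "certificate p n c f"
  shows "has_orthogonal_linear g d"
proof -
  define \<theta> where "\<theta> = (\<lambda>x :: 'a. of_int (f (residue x)) :: 'a)"
  have c: "1 < c" "c < p" using cert by (auto simp: certificate_def)
  have com: "z ^ n mod p = 1 \<longleftrightarrow> (\<forall>x\<in>{0..<p}. f (z * x mod p) mod p = z * f x mod p)"
    if "z \<in> {1..<p}" for z
    using cert that by (auto simp: certificate_def list_all_iff)
  have pow: "x ^ n = 1 \<longleftrightarrow> residue x ^ n mod p = 1" for x :: 'a
    using of_int_eq_iff_mod[of "residue x ^ n" 1] p_gt_1 by (simp add: residue)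
  have n0: "n > 0" using n card_field_gt_1[where 'a='a] by (auto intro: gr0I)
  have res1: "residue x \<in> {1..<p}" if "x \<noteq> 0" for x
    using residue[of x] that by (cases "residue x = 0") auto
  have th: "\<theta> (z * x) = z * \<theta> x \<longleftrightarrow>
      f (residue z * residue x mod p) mod p = residue z * f (residue x) mod p" for z x
  proof -
    have "residue (z * x) = residue z * residue x mod p"
      using residue_of_int[of "residue z * residue x"] by (simp add: residue)
    moreover have "z * \<theta> x = of_int (residue z * f (residue x))"
      by (simp add: \<theta>_def residue)
    ultimately show ?thesis by (simp only: \<theta>_def of_int_eq_iff_mod)
  qed
  show ?thesis
  proof (rule has_orthogonal_linearI[where \<theta> = \<theta> and c = "of_int c", OF g d n])
    show "of_int c \<noteq> (0 :: 'a)" "of_int c \<noteq> (1 :: 'a)"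
      using of_int_eq_iff_mod[of c 0] of_int_eq_iff_mod[of c 1] c by auto
    show "\<theta> 0 = 0" using cert by (simp add: \<theta>_def certificate_def)
    fix t assume "t \<in> {0, 1, of_int c :: 'a}"
    then obtain k where k: "k \<in> {0, 1, c}" "t = of_int k" by force
    then have "distinct (map (\<lambda>x. (f x - k * x) mod p) [0..p - 1])"
      using cert by (auto simp: certificate_def)
    then have inj: "inj_on (\<lambda>x. (f x - k * x) mod p) {0..<p}"
      by (simp add: distinct_map atLeastLessThanPlusOne_atLeastAtMost_int[symmetric])
    show "inj (\<lambda>x. \<theta> x - t * x)"
    proof (rule injI)
      fix x y assume "\<theta> x - t * x = \<theta> y - t * y"
      moreover have "\<theta> x - t * x = of_int (f (residue x) - k * residue x)" for x
        by (simp add: \<theta>_def k residue)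
      ultimately have "(f (residue x) - k * residue x) mod p = (f (residue y) - k * residue y) mod p"
        by (simp only: of_int_eq_iff_mod)
      then have "residue x = residue y" by (rule inj_onD[OF inj _ residue(1) residue(1)])
      then show "x = y" by (metis residue(2))
    qed
  next
    fix h x :: 'a assume h: "h ^ n = 1"
    then have "h \<noteq> 0" using n0 by (auto simp: zero_power)
    then show "\<theta> (h * x) = h * \<theta> x"
      using com[of "residue h"] res1 h residue(1)[of x] by (simp add: th pow)
  next
    fix \<zeta> :: 'a assume \<zeta>: "\<zeta> \<noteq> 0" and "\<And>x. \<theta> (\<zeta> * x) = \<zeta> * \<theta> x"
    then have *: "f (residue \<zeta> * residue x mod p) mod p = residue \<zeta> * f (residue x) mod p" for x
      using th by blast
    have "f (residue \<zeta> * i mod p) mod p = residue \<zeta> * f i mod p" if "i \<in> {0..<p}" for i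
      using *[of "of_int i"] that by (simp add: residue_of_int)
    then show "\<zeta> ^ n = 1" using com res1[OF \<zeta>] by (simp add: pow)
  qed
qed

section \<open>Exhaustive search for nonexistence\<close>

fun compatible ::
    "int \<Rightarrow> int \<Rightarrow> int \<Rightarrow> int \<Rightarrow> (int \<times> int \<times> int \<times> int) list \<Rightarrow> bool" where
  "compatible x v a b [] = True"
| "compatible x v a b ((y, w, a', b') # ps) =
    (if y = x then compatible x v a b ps else if v = w then False else if a = a' then False
     else if b = b' then False else compatible x v a b ps)"

text \<open>\<open>extensions_commute p c hs ks ps xs\<close> tries all ways of extending the partial map \<open>ps\<close> to
  the points \<open>xs\<close> and their multiples by \<open>hs\<close>, keeping \<open>\<theta>\<close>, \<open>\<theta> - x\<close> and \<open>\<theta> - c x\<close> injective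
  modulo \<open>p\<close>, and checks that every complete extension commutes with all factors in \<open>ks\<close>.
  The entries of \<open>ps\<close> are \<open>(x, \<theta> x, \<theta> x - x, \<theta> x - c x)\<close>. The nested conditionals above and
  here are evaluated lazily by \<open>code_simp\<close>, unlike conjunctions.\<close>

fun extensions_commute ::
    "int \<Rightarrow> int \<Rightarrow> int list \<Rightarrow> int list \<Rightarrow> (int \<times> int \<times> int \<times> int) list \<Rightarrow> int list \<Rightarrow> bool" where
  "extensions_commute p c hs ks ps [] \<longleftrightarrow>
     list_all (\<lambda>k. list_all (\<lambda>(x, v, _).
       map_option fst (map_of ps (k * x mod p)) = Some (k * v mod p)) ps) ks"
| "extensions_commute p c hs ks ps (x # xs) \<longleftrightarrow>
     list_all (\<lambda>v.
       if compatible x v ((v - x) mod p) ((v - c * x) mod p) ps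
       then extensions_commute p c hs ks
         (map (\<lambda>h. (h * x mod p, h * v mod p, (h * v - h * x) mod p,
           (h * v - c * (h * x)) mod p)) hs @ ps) xs
       else True) [0..p - 1]"

lemma compatibleI:
  assumes "\<And>y w a' b'. (y, w, a', b') \<in> set ps \<Longrightarrow> y \<noteq> x \<Longrightarrow> v \<noteq> w \<and> a \<noteq> a' \<and> b \<noteq> b'"
  shows "compatible x v a b ps"
  using assms by (induction x v a b ps rule: compatible.induct) auto

text \<open>The induction keeps two invariants: \<open>ps\<close> records true values of
  \<open>\<theta>\<close>, and \<open>ps\<close> together with the orbits of the remaining points
  covers all residues. At the end \<open>ps\<close> is the full table of \<open>\<theta>\<close>, so
  the final check applies to \<open>\<theta>\<close> itself.\<close>

lemma (in prime_order_field) extensions_commute_sound: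
  fixes \<theta> :: "'a \<Rightarrow> 'a" and c :: int
  defines "T \<equiv> \<lambda>i. residue (\<theta> (of_int i))"
  defines "E \<equiv> \<lambda>i. (i, T i, (T i - i) mod p, (T i - c * i) mod p)"
  assumes inj: "\<And>t. t \<in> {0, 1, of_int c} \<Longrightarrow> inj (\<lambda>x. \<theta> x - t * x)"
    and com: "\<And>h x. h \<in> set hs \<Longrightarrow> \<theta> (of_int h * x) = of_int h * \<theta> x"
    and "extensions_commute p c hs ks ps xs"
    and "set ps \<subseteq> E ` {0..<p}"
    and "set xs \<subseteq> {0..<p}"
    and "{0..<p} \<subseteq> fst ` set ps \<union> {h * x mod p | h x. h \<in> set hs \<and> x \<in> set xs}"
    and "k \<in> set ks"
  shows "\<theta> (of_int k * x) = of_int k * \<theta> x"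
  using assms(5-9)
proof (induction xs arbitrary: ps)
  case Nil
  have mem: "E i \<in> set ps" if "i \<in> {0..<p}" for i
  proof -
    have "i \<in> fst ` set ps" using Nil.prems(4) that by auto
    then obtain e where "e \<in> set ps" "fst e = i" by blast
    moreover from this obtain i' where "e = E i'" using Nil.prems(2) by blast
    ultimately show ?thesis by (simp add: E_def)
  qed
  define i where "i = residue x"
  have i: "i \<in> {0..<p}" "x = of_int i" using residue[of x] by (simp_all add: i_def)
  have "map_option fst (map_of ps (k * i mod p)) = Some (k * T i mod p)"
    using Nil.prems(1,5) mem[OF i(1)] unfolding E_def by (force simp: list_all_iff)
  then obtain a b where "map_of ps (k * i mod p) = Some (k * T i mod p, a, b)" by auto
  then have "(k * i mod p, k * T i mod p, a, b) \<in> E ` {0..<p}"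
    using Nil.prems(2) by (blast dest: map_of_SomeD)
  then have "T (k * i mod p) = k * T i mod p" by (auto simp: E_def)
  then have "of_int (T (k * i mod p)) = (of_int (k * T i) :: 'a)" by simp
  then show ?case by (simp add: T_def residue i(2))
next
  case (Cons y ys)
  \<comment> \<open>The search branch with the true value is followed; it survives the compatibility
    test because the three maps are injective.\<close>
  define v where "v = T y"
  have y: "y \<in> {0..<p}" using Cons.prems(3) by simp
  have T: "T z \<in> {0..<p}" for z unfolding T_def by (rule residue(1))
  then have v: "v \<in> set [0..p - 1]" using T[of y] by (simp add: v_def)
  have ne: "(T y - t * y) mod p \<noteq> (T z - t * z) mod p"
    if "z \<in> {0..<p}" "z \<noteq> y" "t \<in> {0, 1, c}" for z t
  proof
    assume "(T y - t * y) mod p = (T z - t * z) mod p"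
    then have "of_int (T y - t * y) = (of_int (T z - t * z) :: 'a)" by (simp only: of_int_eq_iff_mod)
    then have eq: "\<theta> (of_int y) - of_int t * of_int y = \<theta> (of_int z) - of_int t * of_int z"
      by (simp add: T_def residue)
    have "inj (\<lambda>x. \<theta> x - of_int t * x)" using that by (intro inj) auto
    then have "of_int y = (of_int z :: 'a)" using eq by (rule injD)
    then show False using y that by (simp add: of_int_eq_iff_mod)
  qed
  have "compatible y v ((v - y) mod p) ((v - c * y) mod p) ps"
  proof (rule compatibleI)
    fix z w a' b' assume "(z, w, a', b') \<in> set ps" "z \<noteq> y"
    then have "z \<in> {0..<p}" "(z, w, a', b') = E z" using Cons.prems(2) by (auto simp: E_def)
    then show "v \<noteq> w \<and> (v - y) mod p \<noteq> a' \<and> (v - c * y) mod p \<noteq> b'"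
      using ne[of z 0] ne[of z 1] ne[of z c] \<open>z \<noteq> y\<close> by (auto simp: E_def v_def)
  qed
  with bspec[OF Cons.prems(1)[unfolded extensions_commute.simps list_all_iff[of _ "[0..p - 1]"]] v]
  have step: "extensions_commute p c hs ks
      (map (\<lambda>h. (h * y mod p, h * v mod p, (h * v - h * y) mod p, (h * v - c * (h * y)) mod p)) hs @ ps) ys"
    by (simp only: if_True)
  have cong_diff_mult: "(a - c * (b mod p)) mod p = (a - c * b) mod p" for a b
    by (metis mod_diff_right_eq mod_mult_right_eq)
  show ?case
  proof (rule Cons.IH[OF step])
    have "(h * y mod p, h * v mod p, (h * v - h * y) mod p, (h * v - c * (h * y)) mod p)
        \<in> E ` {0..<p}" if h: "h \<in> set hs" for h
    proof -
      have "T (h * y mod p) = residue (of_int (h * v))" using h com by (simp add: T_def v_def residue)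
      also have "\<dots> = h * v mod p" by (rule residue_of_int)
      finally have "E (h * y mod p) =
          (h * y mod p, h * v mod p, (h * v - h * y) mod p, (h * v - c * (h * y)) mod p)"
        using cong_diff_mult[of "h * v" "h * y"] by (simp add: E_def mod_simps)
      moreover have "h * y mod p \<in> {0..<p}" using p_gt_1 by simp
      ultimately show ?thesis by (metis imageI)
    qed
    then show "set (map (\<lambda>h. (h * y mod p, h * v mod p, (h * v - h * y) mod p,
        (h * v - c * (h * y)) mod p)) hs @ ps) \<subseteq> E ` {0..<p}"
      using Cons.prems(2) by auto
    show "{0..<p} \<subseteq> fst ` set (map (\<lambda>h. (h * y mod p, h * v mod p, (h * v - h * y) mod p,
        (h * v - c * (h * y)) mod p)) hs @ ps) \<union> {h * x mod p | h x. h \<in> set hs \<and> x \<in> set ys}"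
      (is "_ \<subseteq> ?R")
    proof
      fix i assume "i \<in> {0..<p}"
      then consider "i \<in> fst ` set ps"
        | h x where "h \<in> set hs" "x \<in> set (y # ys)" "i = h * x mod p"
        using Cons.prems(4) by blast
      then show "i \<in> ?R"
      proof cases
        case 2
        then show ?thesis by (cases "x = y") (force, auto)
      qed auto
    qed
  qed (use Cons.prems in auto)
qed

text \<open>Intended for n = (q - 1) / d and m = (q - 1) / l with l < d: \<open>hs\<close> are
  \<open>n\<close>-th roots of unity, \<open>ks\<close> contains all \<open>m\<close>-th roots, and
  \<open>xs\<close> represents the nonzero orbits. The search starts from the value 0 at 0 and runs
  for every slope \<open>c\<close> other than 0 and 1.\<close>

definition refutation :: "int \<Rightarrow> nat \<Rightarrow> nat \<Rightarrow> int list \<Rightarrow> int list \<Rightarrow> int list \<Rightarrow> bool" where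
  "refutation p n m hs ks xs \<longleftrightarrow>
    list_all (\<lambda>h. h ^ n mod p = 1) hs \<and>
    list_all (\<lambda>k. k ^ m mod p = 1 \<longrightarrow> k \<in> set ks) [0..p - 1] \<and>
    list_all (\<lambda>x. 0 \<le> x \<and> x < p) xs \<and>
    list_all (\<lambda>i. i = 0 \<or> list_ex (\<lambda>h. list_ex (\<lambda>x. i = h * x mod p) xs) hs) [0..p - 1] \<and>
    list_all (\<lambda>c. extensions_commute p c hs ks [(0, 0, 0, 0)] xs) [2..p - 1]"

text \<open>The search shows that a map of index \<open>d\<close> orthogonal to a linear one
  commutes with all \<open>m\<close>-th roots of unity. It then has the smaller index
  \<open>l\<close>, which properness forbids.\<close>

lemma (in prime_order_field) not_has_orthogonal_linear:
  assumes d: "d > 0" "CARD('a) - 1 = n * d"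
    and l: "l < d" "CARD('a) - 1 = m * l"
    and "refutation p n m hs ks xs"
  shows "\<not> has_orthogonal_linear g d"
proof
  assume "has_orthogonal_linear g d"
  then obtain \<theta> \<phi> where \<theta>: "\<theta> \<in> proper_cyclotomic_orths g d" and \<phi>: "\<phi> \<in> linear_orths g"
    and orth: "orthogonal_orth \<theta> \<phi>" by (auto simp: has_orthogonal_linear_def)
  have N: "CARD('a) - 1 > 0" using card_field_gt_1[where 'a='a] by simp
  have l0: "l > 0" using l N by (auto intro: gr0I)
  have dvd: "d dvd CARD('a) - 1" "l dvd CARD('a) - 1"
    using d(2) l(2) by (metis dvd_triv_right)+
  have nm: "(CARD('a) - 1) div d = n" "(CARD('a) - 1) div l = m"
    using d l l0 by (metis nonzero_mult_div_cancel_right less_numeral_extra(3))+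
  have hs: "list_all (\<lambda>h. h ^ n mod p = 1) hs"
    and ks: "list_all (\<lambda>k. k ^ m mod p = 1 \<longrightarrow> k \<in> set ks) [0..p - 1]"
    and xs: "list_all (\<lambda>x. 0 \<le> x \<and> x < p) xs"
    and cover: "list_all (\<lambda>i. i = 0 \<or> list_ex (\<lambda>h. list_ex (\<lambda>x. i = h * x mod p) xs) hs) [0..p - 1]"
    and check: "list_all (\<lambda>c. extensions_commute p c hs ks [(0, 0, 0, 0)] xs) [2..p - 1]"
    using assms(5) unfolding refutation_def by blast+
  obtain c' where c': "c' \<noteq> 0" "c' \<noteq> 1" "\<phi> = (\<lambda>x. c' * x)"
    using \<phi> linear_orths_iff[OF g] by blast
  define c where "c = residue c'"
  have c: "c \<in> {0..<p}" "c' = of_int c" using residue[of c'] by (auto simp: c_def)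
  then have "c \<noteq> 0" "c \<noteq> 1" using c' by auto
  then have c2: "c \<in> set [2..p - 1]" using c by auto
  have in_d: "\<theta> \<in> cyclotomic_orths g d" and not_l: "\<theta> \<notin> cyclotomic_orths g l"
    using \<theta> l dvd by (auto simp: proper_cyclotomic_orths_def)
  have o: "orthomorphism \<theta>" and z: "\<theta> 0 = 0"
    and com: "\<And>h x. h ^ n = 1 \<Longrightarrow> \<theta> (h * x) = h * \<theta> x"
    using in_d cyclotomic_orths_iff[OF g d(1) dvd(1), unfolded nm] by auto
  have inj: "inj (\<lambda>x. \<theta> x - t * x)" if "t \<in> {0, 1, of_int c}" for t
    using that o orth c' c by (auto simp: orthogonal_orth_def orthomorphism_def bij_def)
  have pow: "of_int h ^ m = (1 :: 'a) \<longleftrightarrow> h ^ m mod p = 1" for h m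
    using of_int_eq_iff_mod[of "h ^ m" 1] p_gt_1 by simp
  have "\<theta> (k * x) = k * \<theta> x" if k: "k ^ m = 1" for k x
  proof -
    have rk: "residue k \<in> set ks"
      using ks k residue[of k] pow[of "residue k"] by (auto simp: list_all_iff)
    have "\<theta> (of_int (residue k) * x) = of_int (residue k) * \<theta> x"
    proof (rule extensions_commute_sound[OF inj, of c hs ks "[(0, 0, 0, 0)]" xs])
      show "\<theta> (of_int h * x) = of_int h * \<theta> x" if "h \<in> set hs" for h x
        using hs that by (intro com) (auto simp: list_all_iff pow)
      show "extensions_commute p c hs ks [(0, 0, 0, 0)] xs" using check c2 by (auto simp: list_all_iff)
      show "set [(0, 0, 0, 0)] \<subseteq> (\<lambda>i. (i, residue (\<theta> (of_int i)),
          (residue (\<theta> (of_int i)) - i) mod p, (residue (\<theta> (of_int i)) - c * i) mod p)) ` {0..<p}"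
        using z p_gt_1 by (auto intro!: image_eqI[of _ _ 0])
      show "set xs \<subseteq> {0..<p}" using xs by (auto simp: list_all_iff)
      show "{0..<p} \<subseteq> fst ` set [(0, 0, 0, 0)] \<union> {h * x mod p | h x. h \<in> set hs \<and> x \<in> set xs}"
      proof
        fix i assume "i \<in> {0..<p}"
        then have "i = 0 \<or> (\<exists>h\<in>set hs. \<exists>x\<in>set xs. i = h * x mod p)"
          using cover by (simp add: list_all_iff list_ex_iff)
        then show "i \<in> fst ` set [(0, 0, 0, 0)] \<union> {h * x mod p | h x. h \<in> set hs \<and> x \<in> set xs}" by auto
      qed
    qed (use rk in auto)
    then show ?thesis by (simp add: residue)
  qed
  then have "\<theta> \<in> cyclotomic_orths g l"
    using o z by (simp add: cyclotomic_orths_iff[OF g l0 dvd(2), unfolded nm])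
  then show False using not_l by blast
qed

subsection \<open>The exceptional pairs and the existence result\<close>

text \<open>Two linear orthomorphisms are orthogonal iff their slopes differ, so two different
  elements outside {0, 1} are required.\<close>

lemma has_orthogonal_linear_1_iff:
  fixes g :: "'a::{field,finite}"
  assumes g: "mult_generator g"
  shows "has_orthogonal_linear g 1 \<longleftrightarrow> CARD('a) \<ge> 4"
proof
  assume "has_orthogonal_linear g 1"
  then obtain \<theta> \<phi> where "\<theta> \<in> linear_orths g" "\<phi> \<in> linear_orths g"
    and o: "orthogonal_orth \<theta> \<phi>"
    by (auto simp: has_orthogonal_linear_def proper_cyclotomic_orths_def linear_orths_def)
  then obtain a c where a: "a \<noteq> 0" "a \<noteq> 1" "\<theta> = (\<lambda>x. a * x)"
    and c: "c \<noteq> 0" "c \<noteq> 1" "\<phi> = (\<lambda>x. c * x)"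
    using linear_orths_iff[OF g] by blast
  have "inj (\<lambda>x. \<theta> x - \<phi> x)" using o by (simp add: orthogonal_orth_def bij_def)
  then have "\<theta> 1 - \<phi> 1 \<noteq> \<theta> 0 - \<phi> 0" by (metis injD zero_neq_one)
  then have "card {0, 1, a, c} = 4" using a c by auto
  then show "CARD('a) \<ge> 4" using card_mono[of UNIV "{0, 1, a, c}"] by simp
next
  assume q: "CARD('a) \<ge> 4"
  have ex: "\<exists>x :: 'a. x \<notin> set xs" if "length xs < 4" for xs
  proof (rule ccontr)
    assume "\<not> ?thesis"
    then have "UNIV = set xs" by blast
    then have "CARD('a) \<le> length xs" by (metis card_length)
    then show False using q that by simp
  qed
  obtain a :: 'a where a: "a \<noteq> 0" "a \<noteq> 1" using ex[of "[0, 1]"] by auto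
  obtain c :: 'a where c: "c \<noteq> 0" "c \<noteq> 1" "c \<noteq> a" using ex[of "[0, 1, a]"] by auto
  show "has_orthogonal_linear g 1"
  proof (rule has_orthogonal_linearI[where n = "CARD('a) - 1" and c = c and \<theta> = "\<lambda>x. a * x", OF g])
    fix t assume t: "t \<in> {0, 1, c}"
    show "inj (\<lambda>x. a * x - t * x)"
    proof (rule injI)
      fix x y assume "a * x - t * x = a * y - t * y"
      then have "(a - t) * (x - y) = 0" by (simp add: algebra_simps)
      then show "x = y" using t a c by auto
    qed
  qed (use a c finite_field_power_card_minus_1 in auto)
qed

text \<open>An orthomorphism fixing 0 permutes the three nonzero elements without fixed points. It
  is a 3-cycle, that is, multiplication by \<open>g\<close> or \<open>g * g\<close>, so no
  orthomorphism has 3 as its least index.\<close>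

lemma not_has_orthogonal_linear_4_3:
  fixes g :: "'a::{field,finite}"
  assumes g: "mult_generator g" and q: "CARD('a) = 4"
  shows "\<not> has_orthogonal_linear g 3"
proof
  assume "has_orthogonal_linear g 3"
  then obtain \<theta> where \<theta>: "\<theta> \<in> proper_cyclotomic_orths g 3"
    by (auto simp: has_orthogonal_linear_def)
  then have "\<theta> \<in> cyclotomic_orths g 3" and not_1: "\<theta> \<notin> cyclotomic_orths g 1"
    using q by (auto simp: proper_cyclotomic_orths_def)
  then have o: "orthomorphism \<theta>" and z: "\<theta> 0 = 0"
    using cyclotomic_orths_iff[OF g, of 3 \<theta>] q by auto
  have inj: "inj \<theta>" "inj (\<lambda>x. \<theta> x - x)" using o by (auto simp: orthomorphism_def bij_def)
  have \<theta>0: "\<theta> x \<noteq> 0" "\<theta> x \<noteq> x" if "x \<noteq> 0" for x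
    using injD[OF inj(1), of x 0] injD[OF inj(2), of x 0] that z by auto
  have g0: "g \<noteq> 0" by (rule mult_generator_nonzero[OF g])
  have g3: "g * g * g = 1"
    using mult_generator_power_eq_1_iff[OF g, of 3] q by (simp add: power3_eq_cube)
  have g1: "g \<noteq> 1" using mult_generator_power_eq_1_iff[OF g, of 1] q by simp
  have g2: "g * g \<noteq> 1" "g * g \<noteq> g" using g0 g1 g3 by auto
  have "card {0, 1, g, g * g} = 4" using g0 g1 g2 by auto
  then have U: "x \<in> {0, 1, g, g * g}" for x
    using q by (metis UNIV_I card_subset_eq finite subset_UNIV)
  have ne: "\<theta> 1 \<noteq> \<theta> g" "\<theta> 1 \<noteq> \<theta> (g * g)" "\<theta> g \<noteq> \<theta> (g * g)"
    using injD[OF inj(1)] g1 g2 by metis+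
  have lin: "\<theta> x = \<theta> 1 * x" for x
  proof (cases "\<theta> 1 = g")
    case True
    then have "\<theta> (g * g) = 1" using U[of "\<theta> (g * g)"] \<theta>0[of "g * g"] ne g0 by auto
    moreover from this have "\<theta> g = g * g" using U[of "\<theta> g"] \<theta>0[of g] ne g0 by auto
    ultimately show ?thesis using U[of x] True z g3 by (auto simp: mult.assoc)
  next
    case False
    then have 1: "\<theta> 1 = g * g" using U[of "\<theta> 1"] \<theta>0[of 1] by auto
    then have "\<theta> g = 1" using U[of "\<theta> g"] \<theta>0[of g] ne g0 by auto
    moreover from this have "\<theta> (g * g) = g" using U[of "\<theta> (g * g)"] \<theta>0[of "g * g"] ne g0 by auto
    ultimately show ?thesis using U[of x] 1 z g3 by (auto simp: mult.assoc)
  qed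
  have "\<theta> (h * x) = h * \<theta> x" for h x using lin[of "h * x"] lin[of x] by simp
  then have "\<theta> \<in> cyclotomic_orths g 1" using cyclotomic_orths_iff[OF g, of 1 \<theta>] o z by simp
  then show False using not_1 by blast
qed

text \<open>All but the last force linearity. For order 13 the search forces index 2, which is still
  below 4.\<close>

lemma refutations:
  "refutation 3 1 2 [1] [1, 2] [1, 2]"
  "refutation 5 2 4 [1, 4] [1, 2, 3, 4] [1, 2]"
  "refutation 5 1 4 [1] [1, 2, 3, 4] [1, 2, 3, 4]"
  "refutation 7 3 6 [1, 2, 4] [1, 2, 3, 4, 5, 6] [1, 3]"
  "refutation 7 2 6 [1, 6] [1, 2, 3, 4, 5, 6] [1, 2, 3]"
  "refutation 7 1 6 [1] [1, 2, 3, 4, 5, 6] [1, 2, 3, 4, 5, 6]"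
  "refutation 13 3 6 [1, 3, 9] [1, 3, 4, 9, 10, 12] [1, 2, 4, 8]"
  by code_simp+

text \<open>Each map is linear except on a few orbits of the roots of unity: 1 and -1 for
  \<open>n = 2\<close>, and the cube roots 1, 7, 11 modulo 19 for \<open>n = 3\<close>.\<close>

lemma certificates:
  "certificate 11 2 3 (patched_linear 4 (orbit_table 11 [1, -1] [(1, 7), (2, 5), (4, 3)]))"
  "certificate 19 2 3 (patched_linear 7 (orbit_table 19 [1, -1] [(1, 6), (4, 10), (9, 12)]))"
  "certificate 23 2 4 (patched_linear 13 (orbit_table 23 [1, -1] [(1, 6), (4, 3), (2, 13), (10, 8)]))"
  "certificate 47 2 6 (patched_linear 19 (orbit_table 47 [1, -1]
    [(1, 13), (15, 44), (18, 23), (21, 19)]))"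
  "certificate 59 2 3 (patched_linear 24 (orbit_table 59 [1, -1] [(1, 35), (22, 45), (24, 3)]))"
  "certificate 71 2 2 (patched_linear 17 (orbit_table 71 [1, -1]
    [(1, 27), (22, 1), (12, 9), (25, 17), (35, 19)]))"
  "certificate 83 2 3 (patched_linear 10 (orbit_table 83 [1, -1] [(1, 54), (22, 73), (31, 22)]))"
  "certificate 19 3 3 (patched_linear 14 (orbit_table 19 [1, 7, 11] [(1, 4), (2, 10), (4, 14), (5, 12)]))"
  by code_simp+

lemma exceptional_not_has_orthogonal_linear:
  fixes g :: "'a::{field,finite}"
  assumes g: "mult_generator g" and qd: "(CARD('a), d) \<in> exceptional_pairs"
  shows "\<not> has_orthogonal_linear g d"
proof -
  have *: "\<not> has_orthogonal_linear g d"
    if "CARD('a) = r" "prime r" "d > 0" "r - 1 = n * d" "l < d" "r - 1 = m * l"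
      "refutation (int r) n m hs ks xs" for r n l m hs ks xs
  proof -
    interpret prime_order_field g "int CARD('a)" using g that by unfold_locales auto
    show ?thesis
      using that by (intro not_has_orthogonal_linear[of d n l m hs ks xs]) auto
  qed
  from qd consider "CARD('a) \<in> {2, 3}" "d = 1" | "CARD('a) = 3" "d = 2" | "CARD('a) = 4" "d = 3"
    | "CARD('a) = 5" "d = 2" | "CARD('a) = 5" "d = 4" | "CARD('a) = 7" "d = 2"
    | "CARD('a) = 7" "d = 3" | "CARD('a) = 7" "d = 6" | "CARD('a) = 13" "d = 4"
    by (auto simp: exceptional_pairs_def)
  then show ?thesis
  proof cases
    case 1
    then show ?thesis using has_orthogonal_linear_1_iff[OF g] by auto
  next
    case 2
    then show ?thesis using *[of 3 1 1 2] refutations(1) by simp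
  next
    case 3
    then show ?thesis using not_has_orthogonal_linear_4_3[OF g] by simp
  next
    case 4
    then show ?thesis using *[of 5 2 1 4] refutations(2) by simp
  next
    case 5
    then show ?thesis using *[of 5 1 1 4] refutations(3) by simp
  next
    case 6
    then show ?thesis using *[of 7 3 1 6] refutations(4) by simp
  next
    case 7
    then show ?thesis using *[of 7 2 1 6] refutations(5) by simp
  next
    case 8
    then show ?thesis using *[of 7 1 1 6] refutations(6) by simp
  next
    case 9
    then show ?thesis using *[of 13 3 2 6] refutations(7) by simp
  qed
qed

section \<open>Existence when there are at most three \<open>n\<close>-th roots of unity\<close>

lemma has_orthogonal_linear_prime:
  fixes g :: "'a::{field,finite}"
  assumes g: "mult_generator g" and d: "CARD('a) = n * d + 1" "d > 0"
    and prime: "prime (n * d + 1)" and cert: "certificate (int (n * d + 1)) n c f"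
  shows "has_orthogonal_linear g d"
proof -
  interpret prime_order_field g "int CARD('a)" using g prime d by unfold_locales auto
  show ?thesis using d cert by (intro has_orthogonal_linear_certificate[of d n c f]) auto
qed

lemma has_orthogonal_linear_n_1:
  fixes g :: "'a::{field,finite}"
  assumes g: "mult_generator g" and q: "CARD('a) \<ge> 6" "CARD('a) \<noteq> 7"
  shows "has_orthogonal_linear g (CARD('a) - 1)"
proof (cases "even CARD('a)")
  case True
  have "CARD('a) \<noteq> 6" using prime_dvd_CARD_unique[where 'a='a, of 2 3] by auto
  moreover have "(2 :: 'a) = 0" using prime_dvd_CARD_imp_of_nat_eq_0[where 'a='a, of 2] True by simp
  ultimately show ?thesis using q True by (intro has_orthogonal_linear_n_1_even[OF g]) presburger+
next
  case False
  then show ?thesis using q by (intro has_orthogonal_linear_n_1_odd[OF g]) presburger+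
qed

text \<open>For even \<open>d\<close> the subgroup of order 4 fits once q > 9, and q = 9 has
  characteristic 3. For odd \<open>d\<close> divisible by 3 the subgroup of order 6 fits once q >
  19.\<close>

lemma has_orthogonal_linear_n_2:
  fixes g :: "'a::{field,finite}"
  assumes g: "mult_generator g" and q: "CARD('a) = 2 * d + 1" and d: "d > 3"
    and small: "odd d \<longrightarrow> d \<le> 50"
  shows "has_orthogonal_linear g d"
proof -
  have n: "CARD('a) - 1 = 2 * d" and d0: "d > 0" using q d by auto
  have three: "(3 :: 'a) = 0" if "3 dvd CARD('a)"
    using prime_dvd_CARD_imp_of_nat_eq_0[where 'a='a, of 3] that by simp
  have ne: "CARD('a) \<noteq> p * r * m" if "prime p" "prime r" "p \<noteq> r" for p r m
    using prime_dvd_CARD_unique[where 'a='a, of p r] that by auto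
  show ?thesis
  proof (cases "even d")
    case True
    show ?thesis
    proof (cases "d = 4")
      case True
      then show ?thesis using q three by (intro has_orthogonal_linear_n_2_char_3[OF g d0 n]) auto
    next
      case False
      then show ?thesis using True q d
        by (intro has_orthogonal_linear_even_subgroup[OF g d0 n, of 4]) auto
    qed
  next
    case False
    then obtain k where k: "d = 2 * k + 1" by (rule oddE)
    then have "k \<ge> 2" "k < 25" using d small False by auto
    then have "k \<in> set [2..<25]" by (simp only: set_upt atLeastLessThan_iff)
    \<comment> \<open>In the second case 2 d + 1 has two different prime divisors, and
      \<open>d = 13\<close> gives order 27. The last seven values give the prime orders with
      certificates.\<close>
    then consider "3 dvd d" "d \<ge> 15" | "d \<in> {7, 17, 19, 25, 31, 37, 43, 47, 49}" | "d = 13"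
      | "d = 5" | "d = 9" | "d = 11" | "d = 23" | "d = 29" | "d = 35" | "d = 41"
      by (auto simp: k upt_conv_Cons)
    then show ?thesis
    proof cases
      case 1
      then show ?thesis using q
        by (intro has_orthogonal_linear_even_subgroup[OF g d0 n, of 6]) (auto elim!: dvdE)
    next
      case 2
      have "CARD('a) \<notin> {15, 35, 39, 51, 63, 75, 87, 95, 99}"
        using ne[of 3 5 1] ne[of 5 7 1] ne[of 3 13 1] ne[of 3 17 1] ne[of 3 7 3] ne[of 3 5 5]
          ne[of 3 29 1] ne[of 5 19 1] ne[of 3 11 3] by simp
      then show ?thesis using 2 q by auto
    next
      case 3
      then show ?thesis using q three by (intro has_orthogonal_linear_n_2_char_3[OF g d0 n]) auto
    qed (use has_orthogonal_linear_prime[OF g, of 2 d] q certificates in auto)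
  qed
qed

text \<open>Odd \<open>d\<close> makes q even, hence characteristic 2. For even \<open>d\<close> the
  subgroup of order 6 fits once q > 19; q = 19 has its own certificate, and the excluded values 2
  and 4 are the exceptional orders 7 and 13.\<close>

lemma has_orthogonal_linear_n_3:
  fixes g :: "'a::{field,finite}"
  assumes g: "mult_generator g" and q: "CARD('a) = 3 * d + 1" and d: "d \<noteq> 0" "d \<noteq> 2" "d \<noteq> 4"
  shows "has_orthogonal_linear g d"
proof -
  have n: "CARD('a) - 1 = 3 * d" and d0: "d > 0" using q d by auto
  have "d = 1 \<or> odd d \<and> d \<ge> 3 \<or> d = 6 \<or> even d \<and> d \<ge> 8" using d by presburger
  then consider "d = 1" | "odd d" "d \<ge> 3" | "d = 6" | "even d" "d \<ge> 8" by blast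
  then show ?thesis
  proof cases
    case 1
    then show ?thesis using has_orthogonal_linear_1_iff[OF g] q by simp
  next
    case 2
    then have "(2 :: 'a) = 0"
      using prime_dvd_CARD_imp_of_nat_eq_0[where 'a='a, of 2] q by simp
    then show ?thesis using 2 by (intro has_orthogonal_linear_n_3_char_2[OF g _ n])
  next
    case 3
    then show ?thesis using has_orthogonal_linear_prime[OF g, of 3 d] q certificates(8) by simp
  next
    case 4
    then show ?thesis using q
      by (intro has_orthogonal_linear_even_subgroup[OF g d0 n, of 6]) (auto elim!: evenE)
  qed
qed

theorem theorem4p10:
  fixes g :: "'a::{field,finite}" and q d :: nat
  assumes "q = CARD('a)"
    and "mult_generator g"
    and "d > 0" and "d dvd q - 1"
  shows "((q, d) \<in> exceptional_pairs \<longrightarrow>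
            \<not> (\<exists>\<theta>\<in>proper_cyclotomic_orths g d. \<exists>\<phi>\<in>linear_orths g. orthogonal_orth \<theta> \<phi>)) \<and>
         ((q, d) \<notin> exceptional_pairs \<and>
          \<not> (d > 50 \<and> (q = 2 * d + 1 \<and> [q = 3] (mod 4) \<or> q = 3 * d + 1)) \<longrightarrow>
            (\<exists>\<theta>\<in>proper_cyclotomic_orths g d. \<exists>\<phi>\<in>linear_orths g. orthogonal_orth \<theta> \<phi>))"
  unfolding has_orthogonal_linear_def[symmetric]
proof (intro conjI impI)
  assume "(q, d) \<in> exceptional_pairs"
  then show "\<not> has_orthogonal_linear g d"
    using assms exceptional_not_has_orthogonal_linear by blast
next
  assume A: "(q, d) \<notin> exceptional_pairs \<and>
    \<not> (d > 50 \<and> (q = 2 * d + 1 \<and> [q = 3] (mod 4) \<or> q = 3 * d + 1))"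
  obtain n where n: "q - 1 = n * d" using assms(4) by (metis dvdE mult.commute)
  have q1: "q > 1" using card_field_gt_1[where 'a='a] assms(1) by simp
  then have q: "q = n * d + 1" using n by simp
  have "n > 0" using n q1 by (auto intro: gr0I)
  then consider "n = 1" | "n = 2" | "n = 3" | "n \<ge> 4" by linarith
  then show "has_orthogonal_linear g d"
  proof cases
    case 1
    then have "q \<ge> 6 \<and> q \<noteq> 7"
      using A q assms(3) by (auto simp: exceptional_pairs_def)
    moreover have "d = CARD('a) - 1" using 1 n assms(1) by simp
    ultimately show ?thesis using has_orthogonal_linear_n_1[OF assms(2)] assms(1) by simp
  next
    case 2
    have "d > 3" using A 2 q assms(3) by (auto simp: exceptional_pairs_def)
    moreover have "odd d \<longrightarrow> d \<le> 50"
    proof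
      assume "odd d"
      then have "[q = 3] (mod 4)" using 2 q by (auto simp: cong_def elim!: oddE)
      then show "d \<le> 50" using A 2 q by auto
    qed
    ultimately show ?thesis using has_orthogonal_linear_n_2[OF assms(2)] assms(1) 2 q by simp
  next
    case 3
    then have "d \<noteq> 2" "d \<noteq> 4" using A q by (auto simp: exceptional_pairs_def)
    then show ?thesis using has_orthogonal_linear_n_3[OF assms(2)] assms(1,3) 3 q by simp
  next
    case 4
    then show ?thesis using has_orthogonal_linear_large_subgroup[OF assms(2,3)] assms(1) n by blast
  qed
qed

end
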